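(* Let $d\ge 3$ and $m\ge 1$ be integers and let $k\in\{1,\dots,m\}$. Let $A_1,\dots,A_m\in\mathbb{C}^{d\times d}$ be Hermitian matrices satisfying $\|A_i\|_{S_\infty}\le 1$ for all $i\in\{1,\dots,m\}$, and let $b_1,\dots,b_m\in\mathbb{R}$. Fix a real number $t\ge 0$. Assume that for every subset $J\subset\{1,\dots,m\}$ with $|J|=k$ there exists a density matrix $\rho_J\in\mathbb{C}^{d\times d}$ (that is, $\rho_J\succeq 0$ and $\mathrm{Tr}(\rho_J)=1$) such that $$|\langle A_j,\rho_J\rangle-b_j|\le t\qquad\text{for all } j\in J .$$ Then there exists a density matrix $\rho\in\mathbb{C}^{d\times d}$ (that is, $\rho\succeq 0$ and $\mathrm{Tr}(\rho)=1$) such that $$|\langle A_i,\rho\rangle-b_i|\le t+21\,\sqrt{\frac{\ln d}{k}}\qquad\text{for all } i\in\{1,\dots,m\} .$$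
   Context: $\|A\|_{S_\infty}$ is the Schatten $\infty$-norm, i.e. the largest singular value (operator norm) of $A$. The inner product on matrices is the Frobenius (Hilbert–Schmidt) inner product $\langle A,B\rangle:=\mathrm{Tr}(A^*B)$, with $A^*$ the conjugate transpose; it is real when both matrices are Hermitian. A matrix is positive semidefinite, written $\rho\succeq 0$, if it is Hermitian with nonnegative spectrum. $\ln$ is the natural logarithm. *)

theory Defs
  imports
    "HOL-Analysis.Analysis"
    "Jordan_Normal_Form.Spectral_Radius"
    "Jordan_Normal_Form.Schur_Decomposition"
begin

definition hermitian_mat :: "complex mat \<Rightarrow> bool" where
  "hermitian_mat A \<longleftrightarrow> mat_adjoint A = A"

definition mat_trace :: "complex mat \<Rightarrow> complex" where
  "mat_trace A = (\<Sum>i<dim_row A. A $$ (i, i))"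

definition hs_inner :: "complex mat \<Rightarrow> complex mat \<Rightarrow> complex" where
  "hs_inner A B = mat_trace (mat_adjoint A * B)"

text \<open>The singular values are the square roots of the eigenvalues of \<open>A\<^sup>* A\<close>.\<close>

definition singular_values :: "complex mat \<Rightarrow> real set" where
  "singular_values A =
     {s. 0 \<le> s \<and> complex_of_real (s\<^sup>2) \<in> spectrum (mat_adjoint A * A)}"

text \<open>\<^const>\<open>Max\<close> is meaningful here unless the matrix has no columns: then there are no
  singular values and the norm is unspecified.\<close>

definition schatten_inf_norm :: "complex mat \<Rightarrow> real" where
  "schatten_inf_norm A = Max (singular_values A)"

definition psd_mat :: "complex mat \<Rightarrow> bool" where
  "psd_mat A \<longleftrightarrow> hermitian_mat A \<and> spectrum A \<subseteq> \<real>\<^sub>\<ge>\<^sub>0"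

definition density_mat :: "nat \<Rightarrow> complex mat \<Rightarrow> bool" where
  "density_mat d \<rho> \<longleftrightarrow> \<rho> \<in> carrier_mat d d \<and> psd_mat \<rho> \<and> mat_trace \<rho> = 1"

end

theory Submission
  imports Defs "HOL-Library.Function_Algebras"
begin

text \<open>Write the constraints as \<open>\<langle>B, \<rho>\<rangle> \<le> 0\<close> for the matrices \<open>B = \<plusminus>A\<^sub>i - c\<close>, with \<open>c\<close> clipped to
  \<open>[-1, 1]\<close>, which is harmless since \<open>\<bar>\<langle>A\<^sub>i, \<rho>\<rangle>\<bar> \<le> 1\<close>. If no density matrix satisfies all of them up to
  the error \<open>21 \<sigma>\<close>, where \<open>\<sigma> = sqrt (ln d / k)\<close>, then by minimax a convex combination of the \<open>B\<close> has inner
  product at least \<open>20 \<sigma>\<close> with every density matrix. Draw \<open>k\<close> of the \<open>B\<close> independently with these weights.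
  A bound on \<open>E Tr X\<^sup>2\<^sup>p\<close>, where \<open>X\<close> is the centred sum and \<open>p\<close> is of order \<open>ln d\<close>, shows that some
  draw has a sum that is positive on all density matrices, so the at most \<open>k\<close> constraints that were drawn
  cannot be satisfied together. The moment bound uses exchangeable pairs and only the Cauchy-Schwarz
  inequality for the Frobenius inner product.\<close>

subsection \<open>Minimax with slack\<close>

text \<open>The square of the positive part has derivative \<open>2 * max 0 x\<close>, which is
  Lipschitz with constant 2. This is the resulting quadratic upper bound; it lets the positive parts
  act as a gradient in the minimax argument.\<close>

lemma pos_part_square_le:
  fixes x y :: real
  shows "(max 0 (x + y))\<^sup>2 \<le> (max 0 x)\<^sup>2 + 2 * max 0 x * y + y\<^sup>2"
proof -
  have *: "(max 0 z)\<^sup>2 \<le> z\<^sup>2" for z :: real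
    by (simp add: max_def)
  show ?thesis
  proof (cases "x \<ge> 0")
    case True
    then show ?thesis using *[of "x + y"] by (simp add: power2_sum)
  next
    case False
    then have "(max 0 (x + y))\<^sup>2 \<le> (max 0 y)\<^sup>2" by (intro power_mono) auto
    also have "\<dots> \<le> y\<^sup>2" by (rule *)
    finally show ?thesis using False by simp
  qed
qed

text \<open>The multipliers are the positive parts of an approximate minimiser of
  \<open>\<Sum>i. (max 0 (x i))\<^sup>2\<close>; tolerating the slack \<open>\<eta>\<close> makes compactness unnecessary.\<close>

lemma approximate_minimax:
  fixes S :: "('i \<Rightarrow> real) set"
  assumes fin: "finite I" and ne: "S \<noteq> {}"
    and conv: "\<And>x y u. x \<in> S \<Longrightarrow> y \<in> S \<Longrightarrow> 0 \<le> u \<Longrightarrow> u \<le> 1 \<Longrightarrow> (\<lambda>i. (1 - u) * x i + u * y i) \<in> S"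
    and bdd: "\<And>x i. x \<in> S \<Longrightarrow> i \<in> I \<Longrightarrow> \<bar>x i\<bar> \<le> K"
    and eta: "\<eta> > 0"
    and infeasible: "\<And>x. x \<in> S \<Longrightarrow> \<exists>i\<in>I. x i > \<eta>"
  obtains w where "\<And>i. i \<in> I \<Longrightarrow> w i \<ge> 0" "(\<Sum>i\<in>I. w i) = 1"
    "\<And>x. x \<in> S \<Longrightarrow> (\<Sum>i\<in>I. w i * x i) \<ge> (0::real)"
proof -
  define g where "g x = (\<Sum>i\<in>I. (max 0 (x i))\<^sup>2)" for x :: "'i \<Rightarrow> real"
  have g_ge: "g x \<ge> \<eta>\<^sup>2" if "x \<in> S" for x
  proof -
    obtain i where i: "i \<in> I" "x i > \<eta>" using infeasible[OF \<open>x \<in> S\<close>] by blast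
    have "\<eta>\<^sup>2 \<le> (max 0 (x i))\<^sup>2" using i eta by (intro power_mono) auto
    also have "\<dots> \<le> g x" unfolding g_def using fin i by (intro member_le_sum) auto
    finally show ?thesis .
  qed
  define G where "G = Inf (g ` S)"
  have bb: "bdd_below (g ` S)" using g_ge by (intro bdd_belowI2)
  have G_le: "G \<le> g x" if "x \<in> S" for x unfolding G_def using bb that by (intro cINF_lower)
  have "G \<ge> \<eta>\<^sup>2" unfolding G_def using ne g_ge by (intro cINF_greatest)
  then have G0: "G > 0" using eta by (smt (verit) zero_less_power)
  \<comment> \<open>\<open>R - 1\<close> bounds the squared distance, over the coordinates in
    \<open>I\<close>, between two points of \<open>S\<close>. The step size \<open>u\<close> is
    chosen so that the second-order term \<open>u\<^sup>2 * (R - 1)\<close> stays below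
    \<open>u * G\<close>.\<close>
  define R where "R = 1 + real (card I) * (2 * K)\<^sup>2"
  have R0: "R \<ge> 1" unfolding R_def by simp
  define u where "u = min 1 (G / R)"
  have u: "0 < u" "u \<le> 1" "u * R \<le> G" using G0 R0 by (auto simp: u_def min_def field_simps)
  have "Inf (g ` S) < G + u * G" using G0 u by (simp add: G_def)
  then obtain x where x: "x \<in> S" "g x < G + u * G"
    using cInf_lessD[of "g ` S"] ne by blast
  define v where "v i = max 0 (x i)" for i
  have vx: "(\<Sum>i\<in>I. v i * x i) = g x"
    unfolding g_def v_def by (intro sum.cong) (auto simp: max_def power2_eq_square)
  \<comment> \<open>First-order optimality: moving from \<open>x\<close> by the fraction
    \<open>u\<close> towards \<open>y\<close> cannot bring \<open>g\<close> below \<open>G\<close>.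
    The first-order change is \<open>2 * u * ((\<Sum>i\<in>I. v i * y i) - g x)\<close>, and the
    excess \<open>g x - G\<close> and the second-order term are each at most \<open>u * G\<close>.
    Hence the sum is at least \<open>g x - G\<close>, which is nonnegative.\<close>
  have main: "(\<Sum>i\<in>I. v i * y i) \<ge> 0" if y: "y \<in> S" for y
  proof -
    define z where "z i = (1 - u) * x i + u * y i" for i
    have "z \<in> S" using conv[OF x(1) y, of u] u unfolding z_def[abs_def] by simp
    then have "G \<le> g z" by (rule G_le)
    also have "g z \<le> (\<Sum>i\<in>I. (v i)\<^sup>2 + 2 * u * (v i * y i - v i * x i) + u\<^sup>2 * (2 * K)\<^sup>2)"
      unfolding g_def
    proof (rule sum_mono)
      fix i assume i: "i \<in> I"
      have z: "z i = x i + u * (y i - x i)" by (simp add: z_def algebra_simps)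
      have "\<bar>y i - x i\<bar> \<le> 2 * K" using bdd[OF x(1) i] bdd[OF y i] by linarith
      then have "(y i - x i)\<^sup>2 \<le> (2 * K)\<^sup>2"
        by (rule power2_le_iff_abs_le[THEN iffD2, rotated]) (use bdd[OF x(1) i] in linarith)
      then have "(u * (y i - x i))\<^sup>2 \<le> u\<^sup>2 * (2 * K)\<^sup>2"
        unfolding power_mult_distrib by (rule mult_left_mono) simp
      with pos_part_square_le[of "x i" "u * (y i - x i)"]
      show "(max 0 (z i))\<^sup>2 \<le> (v i)\<^sup>2 + 2 * u * (v i * y i - v i * x i) + u\<^sup>2 * (2 * K)\<^sup>2"
        unfolding z v_def by (simp add: algebra_simps)
    qed
    also have "\<dots> = g x + 2 * u * ((\<Sum>i\<in>I. v i * y i) - g x) + u\<^sup>2 * (R - 1)"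
      unfolding vx[symmetric] by (simp add: sum.distrib sum_subtractf sum_distrib_left [symmetric] R_def)
         (simp add: g_def v_def vx[unfolded v_def])
    finally have "G \<le> g x + 2 * u * ((\<Sum>i\<in>I. v i * y i) - g x) + u\<^sup>2 * (R - 1)" .
    moreover have "u\<^sup>2 * (R - 1) \<le> u * G"
    proof -
      have "u\<^sup>2 * (R - 1) \<le> u * (u * R)" using u by (simp add: power2_eq_square algebra_simps)
      also have "\<dots> \<le> u * G" using u by (intro mult_left_mono) auto
      finally show ?thesis .
    qed
    ultimately have "2 * u * G \<le> 2 * u * (\<Sum>i\<in>I. v i * y i) + 2 * u * (G - g x) + 2 * u * G"
      using x(2) by (simp add: algebra_simps)
    also have "\<dots> \<le> 2 * u * (\<Sum>i\<in>I. v i * y i) + 2 * u * G"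
      using G_le[OF x(1)] u by (simp add: mult_nonneg_nonpos)
    finally have "0 \<le> 2 * u * (\<Sum>i\<in>I. v i * y i)" by simp
    then show ?thesis using u by (simp add: zero_le_mult_iff)
  qed
  have v0: "v i \<ge> 0" for i by (simp add: v_def)
  \<comment> \<open>The multipliers can be normalised: if all positive parts vanished,
    \<open>g x\<close> would be 0, whereas the slack forces it to be at least
    \<open>\<eta>\<^sup>2\<close>.\<close>
  have "(\<Sum>i\<in>I. v i) \<noteq> 0"
  proof
    assume "(\<Sum>i\<in>I. v i) = 0"
    then have "\<forall>i\<in>I. v i = 0" using v0 fin by (simp add: sum_nonneg_eq_0_iff)
    then have "g x = 0" by (simp add: g_def v_def)
    then show False using g_ge[OF x(1)] eta by simp
  qed
  then have W: "(\<Sum>i\<in>I. v i) > 0" using v0 by (simp add: less_le sum_nonneg)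
  show thesis
  proof (rule that[of "\<lambda>i. v i / (\<Sum>i\<in>I. v i)"])
    show "0 \<le> (\<Sum>i\<in>I. v i / (\<Sum>i\<in>I. v i) * y i)" if "y \<in> S" for y
      using main[OF that] W by (simp add: sum_divide_distrib[symmetric])
  qed (use v0 W in \<open>auto simp: sum_divide_distrib[symmetric]\<close>)
qed

subsection \<open>Independent samples\<close>

text \<open>Expectation over \<open>k\<close> independent draws with weights \<open>w\<close>, as a
  finite sum; the extensional function space makes each sample occur exactly once.\<close>

definition expect :: "nat \<Rightarrow> 'i set \<Rightarrow> ('i \<Rightarrow> real) \<Rightarrow> ((nat \<Rightarrow> 'i) \<Rightarrow> real) \<Rightarrow> real" where
  "expect k I w f = (\<Sum>\<iota>\<in>{..<k} \<rightarrow>\<^sub>E I. (\<Prod>j<k. w (\<iota> j)) * f \<iota>)"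

lemma expect_mono:
  assumes "\<And>i. i \<in> I \<Longrightarrow> w i \<ge> 0" "\<And>\<iota>. \<iota> \<in> {..<k} \<rightarrow>\<^sub>E I \<Longrightarrow> f \<iota> \<le> g \<iota>"
  shows "expect k I w f \<le> expect k I w g"
  unfolding expect_def by (intro sum_mono mult_left_mono prod_nonneg assms) (auto simp: assms PiE_mem)

lemma expect_cong:
  assumes "\<And>\<iota>. \<iota> \<in> {..<k} \<rightarrow>\<^sub>E I \<Longrightarrow> f \<iota> = g \<iota>"
  shows "expect k I w f = expect k I w g"
  unfolding expect_def using assms by (intro sum.cong) auto

lemma expect_add: "expect k I w (\<lambda>\<iota>. f \<iota> + g \<iota>) = expect k I w f + expect k I w g"
  by (simp add: expect_def algebra_simps sum.distrib)

lemma expect_cmult: "expect k I w (\<lambda>\<iota>. c * f \<iota>) = c * expect k I w f"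
  by (simp add: expect_def sum_distrib_left mult.left_commute)

lemma expect_sum: "expect k I w (\<lambda>\<iota>. \<Sum>a\<in>T. f a \<iota>) = (\<Sum>a\<in>T. expect k I w (f a))"
  unfolding expect_def sum_distrib_left by (rule sum.swap)

lemma expect_const:
  assumes "finite I" "(\<Sum>i\<in>I. w i) = 1"
  shows "expect k I w (\<lambda>_. c) = c"
proof -
  have "(\<Sum>\<iota>\<in>{..<k} \<rightarrow>\<^sub>E I. \<Prod>j<k. w (\<iota> j)) = (\<Prod>j<k. \<Sum>i\<in>I. w i)"
    using assms(1) by (subst prod_sum_PiE) auto
  then show ?thesis unfolding expect_def sum_distrib_right[symmetric] by (simp add: assms(2))
qed

text \<open>Exchangeability: replacing one entry by an independent copy is an involution on pairs
  (sample, fresh entry) that preserves the weights.\<close>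

lemma expect_resample_swap:
  assumes "finite I" "j < k"
  shows "expect k I w (\<lambda>\<iota>. \<Sum>i\<in>I. w i * f \<iota> (\<iota>(j := i))) =
         expect k I w (\<lambda>\<iota>. \<Sum>i\<in>I. w i * f (\<iota>(j := i)) \<iota>)"
proof -
  let ?P = "{..<k} \<rightarrow>\<^sub>E I" and ?W = "\<lambda>\<iota>. \<Prod>j<k. w (\<iota> j)"
  \<comment> \<open>The joint weight of sample and fresh entry is unchanged by the exchange. The
    identity is kept free of division because single weights may be zero.\<close>
  have W: "?W (\<iota>(j := i)) * w (\<iota> j) = ?W \<iota> * w i" for \<iota> i
  proof -
    have "?W \<iota>' = w (\<iota>' j) * (\<Prod>l\<in>{..<k} - {j}. w (\<iota>' l))" for \<iota>'
      using assms(2) by (intro prod.remove) auto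
    note this[of \<iota>] this[of "\<iota>(j := i)"]
    moreover have "(\<Prod>l\<in>{..<k} - {j}. w ((\<iota>(j := i)) l)) = (\<Prod>l\<in>{..<k} - {j}. w (\<iota> l))"
      by (intro prod.cong) auto
    ultimately show ?thesis by (simp add: algebra_simps)
  qed
  have "(\<Sum>\<iota>\<in>?P. \<Sum>i\<in>I. ?W \<iota> * (w i * f \<iota> (\<iota>(j := i)))) =
        (\<Sum>\<iota>\<in>?P. \<Sum>i\<in>I. ?W \<iota> * (w i * f (\<iota>(j := i)) \<iota>))"
    unfolding sum.cartesian_product split_def
  proof (rule sum.reindex_bij_witness[of _ "\<lambda>(\<iota>, i). (\<iota>(j := i), \<iota> j)" "\<lambda>(\<iota>, i). (\<iota>(j := i), \<iota> j)"], goal_cases)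
    case (5 a)
    then show ?case using W[of "fst a" "snd a"] by (auto simp: split_def mult.assoc[symmetric])
  qed (use assms(2) in \<open>auto simp: split_def PiE_mem fun_upd_idem PiE_def extensional_def\<close>)
  then show ?thesis unfolding expect_def sum_distrib_left .
qed

subsection \<open>Matrices as functions\<close>

type_synonym cmat = "nat \<Rightarrow> nat \<Rightarrow> complex"

definition adj :: "cmat \<Rightarrow> cmat" where
  "adj A = (\<lambda>i j. cnj (A j i))"

definition msmult :: "complex \<Rightarrow> cmat \<Rightarrow> cmat" where
  "msmult c A = (\<lambda>i j. c * A i j)"

locale corner_matrices = fixes d :: nat
begin

text \<open>Products are truncated to the \<open>d \<times> d\<close> corner and the inner product only looks there, so
  that entries outside the corner never matter and the laws below need no side conditions.\<close>

definition mm :: "cmat \<Rightarrow> cmat \<Rightarrow> cmat" where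
  "mm A B = (\<lambda>i j. if i < d \<and> j < d then \<Sum>l<d. A i l * B l j else 0)"

definition mone :: cmat where
  "mone = (\<lambda>i j. if i = j \<and> i < d then 1 else 0)"

fun mpow :: "cmat \<Rightarrow> nat \<Rightarrow> cmat" where
  "mpow A 0 = mone"
| "mpow A (Suc n) = mm A (mpow A n)"

text \<open>Taking the real part gives a symmetric real bilinear form for arbitrary complex
  matrices, not only Hermitian ones.\<close>

definition ip :: "cmat \<Rightarrow> cmat \<Rightarrow> real" where
  "ip A B = Re (\<Sum>i<d. \<Sum>j<d. cnj (A i j) * B i j)"

text \<open>The square of the Frobenius norm. For Hermitian \<open>X\<close>,
  \<open>nrm (mpow X p)\<close> is thus the trace of the power of \<open>X\<close> with exponent
  \<open>2 * p\<close>.\<close>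

abbreviation nrm :: "cmat \<Rightarrow> real" where
  "nrm A \<equiv> ip A A"

lemma mm_assoc: "mm (mm A B) C = mm A (mm B C)"
proof (intro ext)
  fix i j
  have "(\<Sum>l<d. (\<Sum>n<d. A i n * B n l) * C l j) = (\<Sum>n<d. A i n * (\<Sum>l<d. B n l * C l j))"
    unfolding sum_distrib_left sum_distrib_right by (subst sum.swap) (simp add: mult.assoc)
  then show "mm (mm A B) C i j = mm A (mm B C) i j" by (simp add: mm_def)
qed

text \<open>Multiplying by \<open>mone\<close> truncates to the corner, so it is a unit only for
  matrices that vanish outside it, such as products and powers.\<close>

lemma mm_mone_left: "mm mone (mm A B) = mm A B" "mm mone (mpow A n) = mpow A n" "mm mone mone = mone"
proof -
  show *: "mm mone (mm A B) = mm A B" for A B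
    by (auto simp: mm_def mone_def fun_eq_iff if_distrib[of "\<lambda>x. x * _"] sum.delta' cong: if_cong)
  show **: "mm mone mone = mone"
    by (auto simp: mm_def mone_def fun_eq_iff if_distrib[of "\<lambda>x. x * _"] sum.delta' cong: if_cong)
  show "mm mone (mpow A n) = mpow A n" by (cases n) (simp_all add: * **)
qed

lemma mm_mone_right: "mm (mm A B) mone = mm A B"
  by (auto simp: mm_def mone_def fun_eq_iff if_distrib[of "\<lambda>x. _ * x"] sum.delta cong: if_cong)

lemma mpow_add: "mpow A (m + n) = mm (mpow A m) (mpow A n)"
  by (induction m) (simp_all add: mm_mone_left mm_assoc)

lemma mpow_Suc_right: "mpow A (Suc n) = mm (mpow A n) A"
proof -
  have "mpow A (Suc n) = mm (mpow A n) (mm A mone)"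
    using mpow_add[of A n 1] by simp
  also have "\<dots> = mm (mm (mpow A n) A) mone" by (simp add: mm_assoc)
  finally show ?thesis by (simp add: mm_mone_right)
qed

lemma mm_diff_left: "mm (A - B) C = mm A C - mm B C"
  by (auto simp: mm_def fun_eq_iff left_diff_distrib sum_subtractf)

lemma mm_diff_right: "mm A (B - C) = mm A B - mm A C"
  by (auto simp: mm_def fun_eq_iff right_diff_distrib sum_subtractf)

lemma mm_msmult_left: "mm (msmult c A) B = msmult c (mm A B)"
  by (auto simp: mm_def msmult_def fun_eq_iff sum_distrib_left mult.assoc)

lemma mm_msmult_right: "mm A (msmult c B) = msmult c (mm A B)"
  by (auto simp: mm_def msmult_def fun_eq_iff sum_distrib_left mult.left_commute)

lemma adj_adj [simp]: "adj (adj A) = A"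
  by (simp add: adj_def)

lemma adj_mm: "adj (mm A B) = mm (adj B) (adj A)"
  by (auto simp: adj_def mm_def fun_eq_iff mult.commute)

lemma adj_mone [simp]: "adj mone = mone"
  by (auto simp: adj_def mone_def fun_eq_iff)

lemma adj_diff: "adj (A - B) = adj A - adj B"
  by (auto simp: adj_def fun_eq_iff)

lemma adj_mpow: "adj A = A \<Longrightarrow> adj (mpow A n) = mpow A n"
proof (induction n)
  case (Suc n)
  then show ?case by (simp only: mpow.simps(2) adj_mm) (metis mpow.simps(2) mpow_Suc_right)
qed simp

section \<open>Algebra of the real Frobenius inner product\<close>

lemma ip_commute: "ip A B = ip B A"
proof -
  have "Re (cnj (A i j) * B i j) = Re (cnj (B i j) * A i j)" for i j by simp
  then show ?thesis unfolding ip_def Re_sum by (simp only:)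
qed

lemma ip_add_right: "ip A (B + C) = ip A B + ip A C"
  by (simp add: ip_def algebra_simps sum.distrib)

lemma ip_diff_right: "ip A (B - C) = ip A B - ip A C"
  by (simp add: ip_def algebra_simps sum_subtractf)

lemma ip_diff_left: "ip (A - B) C = ip A C - ip B C"
  using ip_diff_right[of C A B] by (simp add: ip_commute)

lemma ip_zero_right [simp]: "ip A 0 = 0"
  by (simp add: ip_def)

lemma ip_sum_right: "ip A (\<Sum>x\<in>T. f x) = (\<Sum>x\<in>T. ip A (f x))"
proof (induction T rule: infinite_finite_induct)
  case (insert x F)
  show ?case unfolding sum.insert[OF insert(1,2)] ip_add_right insert(3) ..
qed (simp_all only: sum.infinite sum.empty ip_zero_right not_False_eq_True)

lemma ip_sum_left: "ip (\<Sum>x\<in>T. f x) A = (\<Sum>x\<in>T. ip (f x) A)"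
  using ip_sum_right[of A f T] by (simp add: ip_commute)

lemma ip_msmult_right: "ip A (msmult (of_real c) B) = c * ip A B"
proof -
  have "cnj (A i j) * (of_real c * B i j) = of_real c * (cnj (A i j) * B i j)" for i j by simp
  then show ?thesis unfolding ip_def msmult_def by (simp only: sum_distrib_left[symmetric]) simp
qed

lemma ip_msmult_left: "ip (msmult (of_real c) A) B = c * ip A B"
  using ip_msmult_right[of B c A] by (simp add: ip_commute)

text \<open>Both sides are the same triple sum in different orders. Moving factors across the inner
  product plays the role of the cyclicity of the trace.\<close>

lemma ip_mm_right: "ip A (mm B C) = ip (mm (adj B) A) C"
proof -
  have "(\<Sum>i<d. \<Sum>j<d. cnj (A i j) * (\<Sum>l<d. B i l * C l j)) =
        (\<Sum>i<d. \<Sum>j<d. \<Sum>l<d. cnj (A i j) * B i l * C l j)"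
    by (simp add: sum_distrib_left mult.assoc)
  also have "\<dots> = (\<Sum>j<d. \<Sum>l<d. \<Sum>i<d. cnj (A i j) * B i l * C l j)"
    by (subst sum.swap) (intro sum.cong refl sum.swap)
  also have "\<dots> = (\<Sum>l<d. \<Sum>j<d. \<Sum>i<d. cnj (A i j) * B i l * C l j)"
    by (rule sum.swap)
  also have "\<dots> = (\<Sum>l<d. \<Sum>j<d. cnj (\<Sum>i<d. adj B l i * A i j) * C l j)"
    by (simp only: cnj_sum complex_cnj_mult adj_def complex_cnj_cnj sum_distrib_right)
       (simp only: mult.commute mult.left_commute)
  finally show ?thesis by (simp add: ip_def mm_def)
qed

lemma ip_adj: "ip (adj A) (adj B) = ip A B"
proof -
  have "ip (adj A) (adj B) = Re (\<Sum>j<d. \<Sum>i<d. A i j * cnj (B i j))"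
    by (simp add: ip_def adj_def)
  also have "\<dots> = Re (\<Sum>i<d. \<Sum>j<d. A i j * cnj (B i j))"
    by (subst sum.swap) simp
  finally show ?thesis by (simp add: ip_def)
qed

lemma ip_mm_right': "ip A (mm C B) = ip (mm A (adj B)) C"
proof -
  have "ip A (mm C B) = ip (adj A) (mm (adj B) (adj C))" by (simp add: ip_adj flip: adj_mm)
  also have "\<dots> = ip (adj (mm A (adj B))) (adj C)" by (simp add: ip_mm_right adj_mm)
  finally show ?thesis by (simp add: ip_adj)
qed

lemma nrm_eq: "nrm A = (\<Sum>i<d. \<Sum>j<d. (cmod (A i j))\<^sup>2)"
  by (simp add: ip_def cmod_power2) (simp add: power2_eq_square)

lemma nrm_nonneg: "0 \<le> nrm A"
  by (simp add: nrm_eq sum_nonneg)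

text \<open>Expansion of \<open>nrm (A - B) \<ge> 0\<close>: the Cauchy-Schwarz inequality with the
  geometric mean relaxed to the arithmetic one.\<close>

lemma ip_le_nrm: "2 * ip A B \<le> nrm A + nrm B"
  using nrm_nonneg[of "A - B"] by (simp add: ip_diff_left ip_diff_right ip_commute[of B A])

lemma nrm_mone: "nrm mone = d"
  by (simp add: nrm_eq mone_def if_distrib[of "\<lambda>x. (cmod x)\<^sup>2"] cong: if_cong)

text \<open>Telescoping, replacing one factor \<open>X\<close> by \<open>Y\<close> at a time; the
  order of the factors matters since \<open>X\<close> and \<open>Y\<close> need not commute.\<close>

lemma mpow_diff:
  "mpow X n - mpow Y n = (\<Sum>a<n. mm (mpow X a) (mm (X - Y) (mpow Y (n - Suc a))))"
proof (induction n)
  case (Suc n)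
  have "mpow X (Suc n) - mpow Y (Suc n) = mm X (mpow X n - mpow Y n) + mm (X - Y) (mpow Y n)"
    by (simp add: mm_diff_left mm_diff_right)
  also have "mm X (mpow X n - mpow Y n) =
      (\<Sum>a<n. mm X (mm (mpow X a) (mm (X - Y) (mpow Y (n - Suc a)))))"
  proof -
    have add: "mm X (A + B) = mm X A + mm X B" for A B
      by (auto simp: mm_def fun_eq_iff distrib_left sum.distrib)
    have zero: "mm X 0 = 0" by (auto simp: mm_def fun_eq_iff)
    have "mm X (sum f {..<m}) = (\<Sum>a<m. mm X (f a))" for f :: "nat \<Rightarrow> cmat" and m
      by (induction m) (simp_all only: sum.lessThan_Suc add lessThan_0 sum.empty zero)
    then show ?thesis by (simp only: Suc)
  qed
  also have "\<dots> + mm (X - Y) (mpow Y n) =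
      (\<Sum>a<Suc n. mm (mpow X a) (mm (X - Y) (mpow Y (Suc n - Suc a))))"
    by (subst sum.lessThan_Suc_shift) (simp add: mm_assoc mm_mone_left add.commute)
  finally show ?case .
qed simp

end

subsection \<open>Moments of sums of independent Hermitian matrices\<close>

text \<open>If the leftmost maximiser were interior, its left neighbour would be strictly smaller
  and its right neighbour no larger, contradicting convexity.\<close>

lemma discrete_convex_le_max:
  fixes F :: "nat \<Rightarrow> real"
  assumes conv: "\<And>a. a + 2 \<le> q \<Longrightarrow> 2 * F (a + 1) \<le> F a + F (a + 2)" and "a \<le> q"
  shows "F a \<le> max (F 0) (F q)"
proof -
  define M where "M = Max (F ` {..q})"
  have le: "F b \<le> M" if "b \<le> q" for b unfolding M_def using that by (intro Max_ge) auto
  have ex: "\<exists>b. b \<le> q \<and> F b = M"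
    using Max_in[of "F ` {..q}"] unfolding M_def by fastforce
  define b where "b = (LEAST b. b \<le> q \<and> F b = M)"
  have b: "b \<le> q" "F b = M" using LeastI_ex[OF ex] by (auto simp: b_def)
  have least: "\<not> (c \<le> q \<and> F c = M)" if "c < b" for c
    using not_less_Least[OF that[unfolded b_def]] .
  have "M = F 0 \<or> M = F q"
  proof (cases "b = 0 \<or> b = q")
    case False
    then obtain c where c: "b = c + 1" "c + 2 \<le> q"
      using b(1) by (cases b) auto
    have "c < b" "c \<le> q" using c by auto
    then have "F c \<noteq> M" using least by blast
    then have "F c < M" using le[OF \<open>c \<le> q\<close>] by simp
    moreover have "F (c + 2) \<le> M" using le c by blast
    ultimately have False using conv[OF c(2)] b(2) c(1) by simp
    then show ?thesis ..
  qed (use b in auto)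
  then show ?thesis using le[OF \<open>a \<le> q\<close>] by auto
qed

context corner_matrices
begin

text \<open>Hermitian powers can be moved across the inner product on either side, so the value
  depends only on the exponent sums.\<close>

lemma ip_two_sided:
  assumes "adj X = X" "adj Y = Y"
  shows "ip (mm (mpow X a1) (mm E (mpow Y b1))) (mm (mpow X a2) (mm E (mpow Y b2))) =
         ip E (mm (mpow X (a1 + a2)) (mm E (mpow Y (b2 + b1))))"
proof -
  have "ip (mm (mpow X a1) (mm E (mpow Y b1))) (mm (mpow X a2) (mm E (mpow Y b2))) =
        ip (mm E (mpow Y b1)) (mm (mpow X a1) (mm (mpow X a2) (mm E (mpow Y b2))))"
    by (subst (2) ip_mm_right) (simp add: adj_mpow assms)
  also have "\<dots> = ip E (mm (mm (mpow X a1) (mm (mpow X a2) (mm E (mpow Y b2)))) (mpow Y b1))"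
    by (subst (2) ip_mm_right') (simp add: adj_mpow assms)
  finally show ?thesis by (simp add: mpow_add mm_assoc)
qed

text \<open>The squared norms \<open>F a\<close> of \<open>X\<^sup>a (X - Y) Y\<^sup>q\<^sup>-\<^sup>a\<close> form a convex sequence,
  so only the two extreme terms matter.\<close>

lemma ip_cross_term_le:
  fixes D :: real
  assumes X: "adj X = X" and Y: "adj Y = Y" and a: "a \<le> 2 * q"
    and D: "\<And>Z. nrm (mm (X - Y) Z) \<le> D * nrm Z"
  shows "ip (X - Y) (mm (mpow X a) (mm (X - Y) (mpow Y (2 * q - a)))) \<le>
         D * (nrm (mpow X q) + nrm (mpow Y q))"
proof -
  let ?E = "X - Y"
  define T where "T a = mm (mpow X a) (mm ?E (mpow Y (q - a)))" for a
  define F where "F a = nrm (T a)" for a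
  have T: "ip (T a1) (T a2) = ip ?E (mm (mpow X (a1 + a2)) (mm ?E (mpow Y (2 * q - (a1 + a2)))))"
    if "a1 \<le> q" "a2 \<le> q" for a1 a2
  proof -
    have "q - a2 + (q - a1) = 2 * q - (a1 + a2)" using that by simp
    then show ?thesis unfolding T_def ip_two_sided[OF X Y] by (simp only:)
  qed
  have "F 0 = nrm (mm ?E (mpow Y q))" by (simp add: F_def T_def mm_mone_left)
  then have F0: "F 0 \<le> D * nrm (mpow Y q)" using D by simp
  have "F q = nrm (mm (mpow X q) ?E)"
    by (simp add: F_def T_def mm_mone_right flip: mm_assoc)
  also have "\<dots> = nrm (adj (mm (mpow X q) ?E))" by (simp add: ip_adj)
  also have "\<dots> = nrm (mm ?E (mpow X q))"
    by (simp only: adj_mm adj_diff adj_mpow[OF X] X Y)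
  finally have Fq: "F q \<le> D * nrm (mpow X q)" using D by simp
  \<comment> \<open>The product of \<open>T c\<close> with \<open>T (c + 2)\<close> has the same
    exponent sums as that of \<open>T (c + 1)\<close> with itself, so \<open>ip_le_nrm\<close> gives
    convexity.\<close>
  have "2 * F (c + 1) \<le> F c + F (c + 2)" if "c + 2 \<le> q" for c
    using ip_le_nrm[of "T c" "T (c + 2)"] T[of c "c + 2"] T[of "c + 1" "c + 1"] that
    by (simp add: F_def)
  from discrete_convex_le_max[of q F, OF this]
  have "F c \<le> F 0 + F q" if "c \<le> q" for c
    using that nrm_nonneg[of "T 0"] nrm_nonneg[of "T q"] unfolding F_def by (smt (verit))
  \<comment> \<open>The cross term is the inner product of two of the \<open>T\<close>, obtained by
    halving \<open>a\<close>; rounding up and down both stay within \<open>q\<close> because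
    \<open>a \<le> 2 * q\<close>.\<close>
  moreover have half: "a div 2 \<le> q" "a - a div 2 \<le> q" using a by linarith+
  ultimately have "F (a div 2) + F (a - a div 2) \<le> 2 * (F 0 + F q)" by (smt (verit))
  moreover have "2 * ip (T (a div 2)) (T (a - a div 2)) \<le> F (a div 2) + F (a - a div 2)"
    unfolding F_def by (rule ip_le_nrm)
  ultimately have "ip (T (a div 2)) (T (a - a div 2)) \<le> D * (nrm (mpow X q) + nrm (mpow Y q))"
    using F0 Fq by (simp add: algebra_simps)
  then show ?thesis using T[OF half] by simp
qed

text \<open>Telescoping produces \<open>2 * q + 1\<close> cross terms. The odd exponent leaves the
  even total \<open>2 * q\<close> around the middle difference, as the halving in
  \<open>ip_cross_term_le\<close> requires.\<close>

lemma ip_diff_mpow_le: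
  fixes D :: real
  assumes X: "adj X = X" and Y: "adj Y = Y" and D: "\<And>Z. nrm (mm (X - Y) Z) \<le> D * nrm Z"
  shows "ip (X - Y) (mpow X (2 * q + 1) - mpow Y (2 * q + 1)) \<le>
         (2 * real q + 1) * (D * (nrm (mpow X q) + nrm (mpow Y q)))"
proof -
  have "ip (X - Y) (mpow X (2 * q + 1) - mpow Y (2 * q + 1)) =
    (\<Sum>a<2 * q + 1. ip (X - Y) (mm (mpow X a) (mm (X - Y) (mpow Y (2 * q - a)))))"
    unfolding mpow_diff ip_sum_right by (intro sum.cong) auto
  also have "\<dots> \<le> (\<Sum>a<2 * q + 1. D * (nrm (mpow X q) + nrm (mpow Y q)))"
    by (intro sum_mono ip_cross_term_le[OF X Y _ D]) auto
  finally show ?thesis by (simp del: mpow.simps add: add.commute)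
qed

lemma adj_sum: "adj (\<Sum>x\<in>T. f x) = (\<Sum>x\<in>T. adj (f x))"
proof (induction T rule: infinite_finite_induct)
  case (insert x F)
  have "adj (A + B) = adj A + adj B" for A B by (auto simp: adj_def fun_eq_iff)
  then show ?case unfolding sum.insert[OF insert(1,2)] by (simp only: insert(3))
qed (simp_all add: adj_def fun_eq_iff)

text \<open>Both sides are the trace of the same even power. One factor \<open>X\<close> is isolated
  so that the moment can be expanded linearly over the summands of \<open>X\<close>.\<close>

lemma nrm_mpow_Suc:
  assumes "adj X = X"
  shows "nrm (mpow X (Suc q)) = ip X (mpow X (2 * q + 1))"
proof -
  have "ip X (mpow X (2 * q + 1)) = ip X (mm (mpow X q) (mpow X (Suc q)))"
    by (simp only: mpow_add[symmetric]) (simp add: mult_2)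
  also have "\<dots> = ip (mm (mpow X q) X) (mpow X (Suc q))"
    by (simp only: ip_mm_right adj_mpow[OF assms])
  finally show ?thesis by (simp only: mpow_Suc_right[symmetric])
qed

text \<open>The method of exchangeable pairs: by centring, one summand may be replaced by its difference
  with an independent copy, and symmetrising turns \<open>X\<^sup>2\<^sup>q\<^sup>+\<^sup>1\<close> into a difference of powers.\<close>

lemma expect_moment_step:
  fixes H :: "'i \<Rightarrow> cmat" and k :: nat and D :: real
  assumes fin: "finite I" and w: "\<And>i. i \<in> I \<Longrightarrow> w i \<ge> 0" "(\<Sum>i\<in>I. w i) = 1"
    and herm: "\<And>i. i \<in> I \<Longrightarrow> adj (H i) = H i"
    and mean: "\<And>Z. (\<Sum>i\<in>I. w i * ip (H i) Z) = 0"
    and D: "\<And>i l Z. i \<in> I \<Longrightarrow> l \<in> I \<Longrightarrow> nrm (mm (H i - H l) Z) \<le> D * nrm Z"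
  defines "X \<equiv> \<lambda>\<iota>. \<Sum>j<k. H (\<iota> j)"
  shows "expect k I w (\<lambda>\<iota>. nrm (mpow (X \<iota>) (Suc q))) \<le>
         k * ((2 * real q + 1) * D * expect k I w (\<lambda>\<iota>. nrm (mpow (X \<iota>) q)))"
proof -
  let ?E = "expect k I w" and ?P = "{..<k} \<rightarrow>\<^sub>E I"
  define T where "T \<iota> = nrm (mpow (X \<iota>) q)" for \<iota>
  define G where "G \<iota> = mpow (X \<iota>) (2 * q + 1)" for \<iota>
  have hX: "adj (X \<iota>) = X \<iota>" if "\<iota> \<in> ?P" for \<iota>
    unfolding X_def adj_sum using that herm by (intro sum.cong) auto
  have one: "?E (\<lambda>\<iota>. ip (H (\<iota> j)) (G \<iota>)) \<le> (2 * real q + 1) * D * ?E T" if j: "j < k" for j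
  proof -
    define f where "f \<iota> \<kappa> = ip (H (\<iota> j) - H (\<kappa> j)) (G \<iota>)" for \<iota> \<kappa>
    have "?E (\<lambda>\<iota>. ip (H (\<iota> j)) (G \<iota>)) = ?E (\<lambda>\<iota>. \<Sum>i\<in>I. w i * f \<iota> (\<iota>(j := i)))"
    proof (rule expect_cong)
      fix \<iota>
      have "(\<Sum>i\<in>I. w i * f \<iota> (\<iota>(j := i))) =
          (\<Sum>i\<in>I. w i) * ip (H (\<iota> j)) (G \<iota>) - (\<Sum>i\<in>I. w i * ip (H i) (G \<iota>))"
        by (simp add: f_def ip_diff_left right_diff_distrib sum_subtractf sum_distrib_right)
      then show "ip (H (\<iota> j)) (G \<iota>) = (\<Sum>i\<in>I. w i * f \<iota> (\<iota>(j := i)))"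
        by (simp add: mean w)
    qed
    moreover note expect_resample_swap[OF fin j, of w f]
    ultimately have "2 * ?E (\<lambda>\<iota>. ip (H (\<iota> j)) (G \<iota>)) =
        ?E (\<lambda>\<iota>. \<Sum>i\<in>I. w i * (f \<iota> (\<iota>(j := i)) + f (\<iota>(j := i)) \<iota>))"
      by (simp add: distrib_left sum.distrib expect_add)
    also have "\<dots> \<le> ?E (\<lambda>\<iota>. \<Sum>i\<in>I. w i * ((2 * real q + 1) * (D * (T \<iota> + T (\<iota>(j := i))))))"
    proof (intro expect_mono sum_mono mult_left_mono w(1))
      fix \<iota> i assume \<iota>: "\<iota> \<in> ?P" and i: "i \<in> I"
      let ?k = "\<iota>(j := i)"
      have k: "?k \<in> ?P" using \<iota> i j by (auto simp: PiE_def extensional_def)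
      have \<iota>j: "\<iota> j \<in> I" using \<iota> j by auto
      have split: "X \<kappa> = H (\<kappa> j) + (\<Sum>l\<in>{..<k} - {j}. H (\<kappa> l))" for \<kappa>
        unfolding X_def using j by (intro sum.remove) auto
      have "(\<Sum>l\<in>{..<k} - {j}. H (?k l)) = (\<Sum>l\<in>{..<k} - {j}. H (\<iota> l))"
        by (intro sum.cong) auto
      \<comment> \<open>The two sums share all summands but the one at \<open>j\<close>, so the
        hypothesis on differences of two \<open>H\<close> bounds the whole change.\<close>
      then have diff: "X \<iota> - X ?k = H (\<iota> j) - H i"
        using split[of \<iota>] split[of ?k] by (simp del: minus_apply plus_fun_apply)
      have "f \<iota> ?k + f ?k \<iota> = ip (X \<iota> - X ?k) (G \<iota> - G ?k)"
        unfolding diff f_def by (simp add: ip_diff_left ip_diff_right)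
      also have "\<dots> \<le> (2 * real q + 1) * (D * (T \<iota> + T ?k))"
        unfolding G_def T_def using D[OF \<iota>j i]
        by (intro ip_diff_mpow_le hX \<iota> k) (simp only: diff)
      finally show "f \<iota> ?k + f ?k \<iota> \<le> (2 * real q + 1) * (D * (T \<iota> + T ?k))" .
    qed
    also have "\<dots> = ?E (\<lambda>\<iota>. (2 * real q + 1) * D *
        ((\<Sum>i\<in>I. w i * T \<iota>) + (\<Sum>i\<in>I. w i * T (\<iota>(j := i)))))"
      unfolding sum.distrib[symmetric] sum_distrib_left
      by (intro expect_cong sum.cong refl) (simp add: algebra_simps)
    also have "\<dots> = (2 * real q + 1) * D *
        (?E (\<lambda>\<iota>. \<Sum>i\<in>I. w i * T \<iota>) + ?E (\<lambda>\<iota>. \<Sum>i\<in>I. w i * T (\<iota>(j := i))))"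
      by (simp only: expect_cmult expect_add)
    \<comment> \<open>A resampled draw has the same law as the original one: exchangeability for a
      function that ignores its second argument.\<close>
    also have "?E (\<lambda>\<iota>. \<Sum>i\<in>I. w i * T (\<iota>(j := i))) = ?E (\<lambda>\<iota>. \<Sum>i\<in>I. w i * T \<iota>)"
      using expect_resample_swap[OF fin j, of w "\<lambda>\<iota> \<kappa>. T \<iota>"] by simp
    also have "?E (\<lambda>\<iota>. \<Sum>i\<in>I. w i * T \<iota>) = ?E T"
      by (simp add: sum_distrib_right[symmetric] w)
    finally show ?thesis by simp
  qed
  have "?E (\<lambda>\<iota>. nrm (mpow (X \<iota>) (Suc q))) = ?E (\<lambda>\<iota>. \<Sum>j<k. ip (H (\<iota> j)) (G \<iota>))"
  proof (rule expect_cong)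
    fix \<iota> assume \<iota>: "\<iota> \<in> ?P"
    have "nrm (mpow (X \<iota>) (Suc q)) = ip (X \<iota>) (G \<iota>)"
      unfolding G_def using hX[OF \<iota>] by (rule nrm_mpow_Suc)
    also have "\<dots> = (\<Sum>j<k. ip (H (\<iota> j)) (G \<iota>))"
      unfolding X_def by (rule ip_sum_left)
    finally show "nrm (mpow (X \<iota>) (Suc q)) = (\<Sum>j<k. ip (H (\<iota> j)) (G \<iota>))" .
  qed
  also have "\<dots> = (\<Sum>j<k. ?E (\<lambda>\<iota>. ip (H (\<iota> j)) (G \<iota>)))" by (rule expect_sum)
  also have "\<dots> \<le> (\<Sum>j<k. (2 * real q + 1) * D * ?E T)" using one by (intro sum_mono) simp
  finally show ?thesis by (simp add: T_def[abs_def])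
qed

text \<open>Iterates the step from \<open>nrm mone = d\<close>. Every step has \<open>q < p\<close>,
  so its factor \<open>2 * q + 1\<close> is below \<open>2 * p\<close> and one constant serves all
  of them.\<close>

lemma expect_moment_le:
  fixes H :: "'i \<Rightarrow> cmat" and k :: nat and D :: real
  assumes fin: "finite I" and w: "\<And>i. i \<in> I \<Longrightarrow> w i \<ge> 0" "(\<Sum>i\<in>I. w i) = 1"
    and herm: "\<And>i. i \<in> I \<Longrightarrow> adj (H i) = H i"
    and mean: "\<And>Z. (\<Sum>i\<in>I. w i * ip (H i) Z) = 0"
    and D: "\<And>i l Z. i \<in> I \<Longrightarrow> l \<in> I \<Longrightarrow> nrm (mm (H i - H l) Z) \<le> D * nrm Z" and "D \<ge> 0"
  shows "expect k I w (\<lambda>\<iota>. nrm (mpow (\<Sum>j<k. H (\<iota> j)) p)) \<le> d * (2 * p * k * D) ^ p"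
proof -
  have "expect k I w (\<lambda>\<iota>. nrm (mpow (\<Sum>j<k. H (\<iota> j)) q)) \<le> d * (2 * p * k * D) ^ q" if "q \<le> p" for q
    using that
  proof (induction q)
    case 0
    then show ?case by (simp add: nrm_mone expect_const[OF fin w(2)])
  next
    case (Suc q)
    let ?e = "expect k I w (\<lambda>\<iota>. nrm (mpow (\<Sum>j<k. H (\<iota> j)) q))"
    have e0: "?e \<ge> 0"
      unfolding expect_def using w(1) by (intro sum_nonneg mult_nonneg_nonneg prod_nonneg nrm_nonneg) auto
    have "expect k I w (\<lambda>\<iota>. nrm (mpow (\<Sum>j<k. H (\<iota> j)) (Suc q))) \<le> k * ((2 * real q + 1) * D * ?e)"
      by (rule expect_moment_step) (use assms in auto)
    also have "\<dots> \<le> k * ((2 * p) * D * ?e)"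
      using Suc.prems \<open>D \<ge> 0\<close> e0 by (intro mult_left_mono mult_right_mono) linarith+
    also have "\<dots> = (2 * p * k * D) * ?e" by (simp add: algebra_simps)
    also have "\<dots> \<le> (2 * p * k * D) * (d * (2 * p * k * D) ^ q)"
      using Suc \<open>D \<ge> 0\<close> by (intro mult_left_mono) auto
    finally show ?case by (simp add: algebra_simps)
  qed
  then show ?thesis by simp
qed

end

subsection \<open>Density matrices\<close>

context corner_matrices
begin

definition mv :: "cmat \<Rightarrow> (nat \<Rightarrow> complex) \<Rightarrow> nat \<Rightarrow> complex" where
  "mv A v i = (\<Sum>j<d. A i j * v j)"

definition vsq :: "(nat \<Rightarrow> complex) \<Rightarrow> real" where
  "vsq v = (\<Sum>i<d. (cmod (v i))\<^sup>2)"

definition qf :: "cmat \<Rightarrow> (nat \<Rightarrow> complex) \<Rightarrow> real" where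
  "qf A v = Re (\<Sum>i<d. cnj (v i) * mv A v i)"

text \<open>Positivity is expressed by the quadratic form, which is linear in \<open>A\<close>; the
  link with the spectrum is made by \<open>psd_if_eigenvalues_nonneg\<close> and
  \<open>density_mat_of_fun\<close>.\<close>

definition psd :: "cmat \<Rightarrow> bool" where
  "psd A \<longleftrightarrow> adj A = A \<and> (\<forall>v. qf A v \<ge> 0)"

definition is_density :: "cmat \<Rightarrow> bool" where
  "is_density R \<longleftrightarrow> psd R \<and> ip mone R = 1"

lemma ip_mone: "ip mone A = (\<Sum>i<d. Re (A i i))"
proof -
  have "ip mone A = Re (\<Sum>i<d. \<Sum>j<d. if j = i then A i i else 0)"
    unfolding ip_def mone_def by (intro arg_cong[where f = Re] sum.cong) auto
  then show ?thesis by simp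
qed

lemma hermitian_form:
  assumes "adj A = A"
  shows "(\<Sum>i<d. cnj (v i) * mv A u i) = cnj (\<Sum>i<d. cnj (u i) * mv A v i)"
proof -
  have "(\<Sum>i<d. cnj (v i) * mv A u i) = (\<Sum>i<d. \<Sum>j<d. cnj (v i) * A i j * u j)"
    by (simp add: mv_def sum_distrib_left mult.assoc)
  also have "\<dots> = (\<Sum>j<d. \<Sum>i<d. cnj (v i) * A i j * u j)" by (rule sum.swap)
  also have "\<dots> = cnj (\<Sum>j<d. cnj (u j) * mv A v j)"
  proof -
    have "cnj (A j i) = A i j" for i j using fun_cong[OF fun_cong[OF assms], of i j] by (simp add: adj_def)
    then show ?thesis by (simp add: mv_def sum_distrib_left mult_ac)
  qed
  finally show ?thesis .
qed

lemma qf_add: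
  assumes "adj A = A"
  shows "qf A (\<lambda>i. v i + u i) = qf A v + 2 * Re (\<Sum>i<d. cnj (u i) * mv A v i) + qf A u"
proof -
  have "Re (\<Sum>i<d. cnj (v i) * mv A u i) = Re (\<Sum>j<d. cnj (u j) * mv A v j)"
    unfolding hermitian_form[OF assms, of v u] by (simp only: cnj.sel)
  moreover have "mv A (\<lambda>i. v i + u i) i = mv A v i + mv A u i" for i
    by (simp add: mv_def distrib_left sum.distrib)
  ultimately show ?thesis unfolding qf_def
    by (simp only: complex_cnj_add distrib_right distrib_left sum.distrib plus_complex.sel)
qed

text \<open>The quadratic in \<open>s\<close> is evaluated at its minimiser \<open>1 / r\<close>.
  For \<open>r = 0\<close> it is linear and can stay nonnegative only if
  \<open>x = 0\<close>.\<close>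

lemma discriminant_le:
  fixes a x r :: real
  assumes "\<And>s. a - 2 * s * x + s\<^sup>2 * x * r \<ge> 0" "x \<ge> 0" "r \<ge> 0"
  shows "x \<le> r * a"
proof (cases "r = 0")
  case True
  have "x = 0"
  proof (rule ccontr)
    assume "x \<noteq> 0"
    then show False using assms(1)[of "(a + 1) / (2 * x)"] True by simp
  qed
  then show ?thesis using True by simp
next
  case False
  then have "0 \<le> a - x / r" using assms(1)[of "1 / r"] by (simp add: power2_eq_square field_simps)
  then show ?thesis using False assms(3) by (simp add: field_simps)
qed

text \<open>Cauchy-Schwarz for the semidefinite form of \<open>A\<close>, applied to
  \<open>v\<close> and each basis vector, bounds one entry by a diagonal entry of \<open>A\<close>
  times the form; summing the diagonal gives the trace.\<close>

lemma vsq_mv_le: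
  assumes "psd A"
  shows "vsq (mv A v) \<le> ip mone A * qf A v"
proof -
  have herm: "adj A = A" and pos: "\<And>v. qf A v \<ge> 0" using assms by (auto simp: psd_def)
  have entry: "(cmod (mv A v i))\<^sup>2 \<le> Re (A i i) * qf A v" if i: "i < d" for i
  proof (rule discriminant_le)
    define x where "x = mv A v i"
    define e where "e c l = (if l = i then c else 0)" for c :: complex and l
    have mve: "mv A (e c) l = A l i * c" for c l
      using i by (simp add: mv_def e_def if_distrib[of "\<lambda>z. _ * z"] sum.delta cong: if_cong)
    have cnje: "(\<Sum>l<d. cnj (e c l) * f l) = cnj c * f i" for c f
      using i by (simp add: e_def if_distrib[of cnj] if_distrib[of "\<lambda>z. z * _"] sum.delta cong: if_cong)
    have qe: "qf A (e c) = (cmod c)\<^sup>2 * Re (A i i)" for c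
    proof -
      have "qf A (e c) = Re (cnj c * (A i i * c))" by (simp add: qf_def mve cnje)
      also have "cnj c * (A i i * c) = A i i * of_real ((cmod c)\<^sup>2)"
        by (simp only: complex_norm_square) (simp only: mult_ac)
      finally show ?thesis by simp
    qed
    from pos[of "e 1"] show "Re (A i i) \<ge> 0" by (simp add: qe)
    \<comment> \<open>Shifting coordinate \<open>i\<close> of \<open>v\<close> by
      \<open>- s * x\<close>, with \<open>x\<close> the entry to be bounded, makes the cross term
      the real number \<open>- 2 * s * (cmod x)\<^sup>2\<close>.\<close>
    fix s :: real
    have "qf A (\<lambda>l. v l + e (- (of_real s * x)) l) =
        qf A v + 2 * Re (- (of_real s * (cnj x * x))) + s\<^sup>2 * (cmod x)\<^sup>2 * Re (A i i)"
      unfolding qf_add[OF herm] cnje qe x_def[symmetric]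
      by (simp only: complex_cnj_minus complex_cnj_mult complex_cnj_complex_of_real norm_minus_cancel
        norm_mult norm_of_real power_mult_distrib power2_abs mult_minus_left mult.assoc)
    also have "cnj x * x = of_real ((cmod x)\<^sup>2)" by (simp only: complex_norm_square mult.commute)
    finally show "0 \<le> qf A v - 2 * s * (cmod (mv A v i))\<^sup>2 + s\<^sup>2 * (cmod (mv A v i))\<^sup>2 * Re (A i i)"
      using pos[of "\<lambda>l. v l + e (- (of_real s * x)) l"] by (simp add: x_def)
  qed simp
  have "vsq (mv A v) \<le> (\<Sum>i<d. Re (A i i) * qf A v)"
    unfolding vsq_def using entry by (intro sum_mono) auto
  then show ?thesis by (simp add: ip_mone sum_distrib_right)
qed

lemma abs_qf_le: "2 * \<bar>qf A v\<bar> \<le> vsq v + vsq (mv A v)"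
proof -
  have le: "2 * Re (cnj a * b) \<le> (cmod a)\<^sup>2 + (cmod b)\<^sup>2" for a b
  proof -
    have "0 \<le> (cmod (a - b))\<^sup>2" by simp
    then show ?thesis by (simp only: cmod_power2) (simp add: power2_eq_square algebra_simps)
  qed
  have "2 * qf A v \<le> vsq v + vsq (mv A v)"
    unfolding qf_def vsq_def Re_sum sum_distrib_left sum.distrib[symmetric]
    by (intro sum_mono) (use le in simp)
  moreover have "- (2 * qf A v) \<le> vsq v + vsq (mv A v)"
    unfolding qf_def vsq_def Re_sum sum_distrib_left sum.distrib[symmetric] sum_negf[symmetric]
  proof (intro sum_mono)
    show "- (2 * Re (cnj (v i) * mv A v i)) \<le> (cmod (v i))\<^sup>2 + (cmod (mv A v i))\<^sup>2" for i
      using le[of "- v i" "mv A v i"] by simp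
  qed
  ultimately show ?thesis by linarith
qed

text \<open>With trace 1, \<open>vsq (mv R v)\<close> is at most \<open>qf R v\<close>; inserted
  into \<open>abs_qf_le\<close>, this absorbs half of the left side.\<close>

lemma qf_density_le:
  assumes "is_density R"
  shows "qf R v \<le> vsq v"
  using abs_qf_le[of R v] vsq_mv_le[of R v] assms by (simp add: is_density_def)

text \<open>\<open>mm Z (adj Z)\<close> is the sum of the rank-one matrices built from the columns
  of \<open>Z\<close>, and each of them pairs with \<open>R\<close> to a value of the form.\<close>

lemma ip_mm_adj_self: "ip R (mm Z (adj Z)) = (\<Sum>l<d. qf R (\<lambda>i. Z i l))"
proof -
  have "ip R (mm Z (adj Z)) = ip (mm R Z) Z"
    by (simp add: ip_mm_right')
  also have "\<dots> = ip Z (mm R Z)" by (rule ip_commute)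
  also have "\<dots> = Re (\<Sum>l<d. \<Sum>i<d. cnj (Z i l) * mv R (\<lambda>i. Z i l) i)"
    unfolding ip_def by (subst sum.swap) (simp add: mm_def mv_def)
  finally show ?thesis by (simp add: qf_def)
qed

text \<open>The first bound sums \<open>qf_density_le\<close> over the columns of \<open>Z\<close>.
  The second is the nonnegativity of a variance: \<open>R\<close> is nonnegative on the square of
  \<open>Z\<close> minus its mean.\<close>

lemma ip_density_square:
  assumes R: "is_density R" and Z: "adj Z = Z"
  shows "ip R (mm Z Z) \<le> nrm Z" "(ip R Z)\<^sup>2 \<le> ip R (mm Z Z)"
proof -
  have pos: "0 \<le> ip R (mm Y (adj Y))" for Y
    unfolding ip_mm_adj_self using R by (intro sum_nonneg) (simp add: is_density_def psd_def)
  have "ip R (mm Z (adj Z)) \<le> (\<Sum>l<d. vsq (\<lambda>i. Z i l))"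
    unfolding ip_mm_adj_self using R by (intro sum_mono qf_density_le)
  also have "\<dots> = nrm Z" unfolding vsq_def nrm_eq by (rule sum.swap)
  finally show "ip R (mm Z Z) \<le> nrm Z" by (simp add: Z)
  define c where "c = ip R Z"
  define Y where "Y = Z - msmult (of_real c) mone"
  have Y: "adj Y = Y"
    unfolding Y_def adj_diff Z by (auto simp: msmult_def adj_def mone_def fun_eq_iff)
  have trunc: "ip R (mm mone Z) = ip R Z" "ip R (mm Z mone) = ip R Z"
    unfolding ip_def
    by (auto intro!: arg_cong[where f = Re] sum.cong
        simp: mm_def mone_def if_distrib[of "\<lambda>x. x * _"] if_distrib[of "\<lambda>x. _ * x"] cong: if_cong)
  have "ip R (mm Y Y) = ip R (mm Z Z) - c * ip R (mm Z mone) - c * ip R (mm mone Z) + c * c * ip R mone"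
    unfolding Y_def
    by (simp only: mm_diff_left mm_diff_right mm_msmult_left mm_msmult_right ip_diff_right ip_msmult_right
        mm_mone_left) (simp add: algebra_simps)
  moreover have "ip R mone = 1" using R by (simp add: is_density_def ip_commute)
  ultimately have "ip R (mm Y Y) = ip R (mm Z Z) - c\<^sup>2"
    by (simp add: trunc c_def power2_eq_square)
  then show "(ip R Z)\<^sup>2 \<le> ip R (mm Z Z)" using pos[of Y] by (simp add: Y c_def)
qed

text \<open>Repeated squaring with the variance inequality replaces an eigenvalue decomposition of
  \<open>X\<close>, which is why the exponents are powers of two.\<close>

lemma ip_density_power_le:
  assumes R: "is_density R" and X: "adj X = X"
  shows "(ip R X) ^ (2 * 2 ^ r) \<le> nrm (mpow X (2 ^ r))"
proof -
  have sq: "(ip R (mpow X n))\<^sup>2 \<le> ip R (mpow X (2 * n))" for n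
    using ip_density_square(2)[OF R adj_mpow[OF X], of n] by (simp add: mult_2 flip: mpow_add)
  have one: "ip R (mpow X 1) = ip R X"
    unfolding ip_def
    by (auto intro!: arg_cong[where f = Re] sum.cong
        simp: mm_def mone_def if_distrib[of "\<lambda>x. _ * x"] cong: if_cong)
  have "\<bar>ip R X\<bar> ^ (2 ^ r) \<le> \<bar>ip R (mpow X (2 ^ r))\<bar>"
  proof (induction r)
    case 0
    then show ?case using one by simp
  next
    case (Suc r)
    have "\<bar>ip R X\<bar> ^ (2 ^ Suc r) = (\<bar>ip R X\<bar> ^ (2 ^ r))\<^sup>2" by (simp flip: power_mult add: mult.commute)
    also have "\<dots> \<le> \<bar>ip R (mpow X (2 ^ r))\<bar>\<^sup>2" using Suc by (intro power_mono) auto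
    also have "\<dots> \<le> ip R (mpow X (2 * 2 ^ r))" using sq by simp
    finally show ?case by simp
  qed
  then have "(\<bar>ip R X\<bar> ^ (2 ^ r))\<^sup>2 \<le> \<bar>ip R (mpow X (2 ^ r))\<bar>\<^sup>2" by (intro power_mono) auto
  then have "(ip R X) ^ (2 * 2 ^ r) \<le> (ip R (mpow X (2 ^ r)))\<^sup>2"
    by (simp add: power_mult[symmetric] mult.commute power_even_abs flip: power_abs)
  also have "\<dots> \<le> nrm (mpow X (2 ^ r))"
    using ip_density_square[OF R adj_mpow[OF X], of "2 ^ r"] by linarith
  finally show ?thesis .
qed

text \<open>A value above 1 in modulus would have unbounded powers, while
  \<open>nrm (mpow A n)\<close> never exceeds \<open>d\<close> for a contraction.\<close>

lemma abs_ip_density_contraction: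
  assumes R: "is_density R" and A: "adj A = A" and contr: "\<And>Z. nrm (mm A Z) \<le> nrm Z"
  shows "\<bar>ip R A\<bar> \<le> 1"
proof (rule ccontr)
  assume "\<not> ?thesis"
  then have gt: "\<bar>ip R A\<bar> > 1" by simp
  have "nrm (mpow A n) \<le> d" for n
  proof (induction n)
    case (Suc n)
    then show ?case using contr[of "mpow A n"] by simp
  qed (simp add: nrm_mone)
  then have bound: "\<bar>ip R A\<bar> ^ (2 * 2 ^ r) \<le> d" for r
    using ip_density_power_le[OF R A, of r] by (simp add: power_even_abs) (meson order_trans)
  obtain n where n: "real d < \<bar>ip R A\<bar> ^ n" using real_arch_pow[OF gt] by blast
  have "\<bar>ip R A\<bar> ^ n \<le> \<bar>ip R A\<bar> ^ (2 * 2 ^ n)"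
  proof (rule power_increasing)
    show "n \<le> 2 * 2 ^ n" using less_exp[of n] by linarith
  qed (use gt in simp)
  with n bound[of n] show False by linarith
qed

end

subsection \<open>Eigenvalues and quadratic forms\<close>

context corner_matrices
begin

lemma left_inverse_exists:
  assumes inj: "\<And>v. \<forall>i<d. mv N v i = 0 \<Longrightarrow> \<forall>i<d. v i = 0"
  obtains G where "\<And>v i. i < d \<Longrightarrow> mv G (mv N v) i = v i"
proof -
  define M where "M = mat d d (\<lambda>(i, j). N i j)"
  have M: "M \<in> carrier_mat d d" by (simp add: M_def)
  have "det M \<noteq> 0"
  proof
    assume "det M = 0"
    then obtain v where v: "v \<in> carrier_vec d" "v \<noteq> 0\<^sub>v d" "M *\<^sub>v v = 0\<^sub>v d"
      using det_0_iff_vec_prod_zero_field[OF M] by blast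
    have "mv N (\<lambda>j. v $ j) i = (M *\<^sub>v v) $ i" if "i < d" for i
      using that v(1) by (simp add: M_def mv_def scalar_prod_def atLeast0LessThan)
    then have "\<forall>i<d. mv N (\<lambda>j. v $ j) i = 0" using v(3) by simp
    then have "\<forall>i<d. v $ i = 0" by (rule inj)
    then have "v = 0\<^sub>v d" using v(1) by (intro eq_vecI) auto
    then show False using v(2) by blast
  qed
  then obtain B where B: "B \<in> carrier_mat d d" and BM: "B * M = 1\<^sub>m d"
    using det_non_zero_imp_unit[OF M, of "()"] by (auto simp: Units_def ring_mat_def)
  show thesis
  proof (rule that[of "\<lambda>i j. B $$ (i, j)"])
    fix v i assume i: "i < d"
    have BMi: "(\<Sum>j<d. B $$ (i, j) * N j l) = (if i = l then 1 else 0)" if "l < d" for l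
    proof -
      have "(B * M) $$ (i, l) = (\<Sum>j<d. B $$ (i, j) * N j l)"
        using B i that by (simp add: M_def scalar_prod_def atLeast0LessThan)
      then show ?thesis using BM i that by simp
    qed
    have "mv (\<lambda>i j. B $$ (i, j)) (mv N v) i = (\<Sum>l<d. (\<Sum>j<d. B $$ (i, j) * N j l) * v l)"
      unfolding mv_def sum_distrib_left sum_distrib_right
      by (subst sum.swap) (simp add: mult.assoc)
    also have "\<dots> = (\<Sum>l<d. if l = i then v l else 0)"
      by (intro sum.cong) (auto simp: BMi)
    finally show "mv (\<lambda>i j. B $$ (i, j)) (mv N v) i = v i" using i by simp
  qed
qed

lemma vsq_nonneg: "0 \<le> vsq v"
  by (simp add: vsq_def sum_nonneg)

lemma vsq_mv_le_nrm: "vsq (mv A v) \<le> nrm A * vsq v"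
proof -
  have "(cmod (mv A v i))\<^sup>2 \<le> (\<Sum>j<d. (cmod (A i j))\<^sup>2) * vsq v" for i
  proof -
    have "cmod (mv A v i) \<le> (\<Sum>j<d. cmod (A i j) * cmod (v j))"
      unfolding mv_def by (rule order_trans[OF norm_sum]) (simp add: norm_mult)
    then have "(cmod (mv A v i))\<^sup>2 \<le> (\<Sum>j<d. cmod (A i j) * cmod (v j))\<^sup>2"
      by (intro power_mono) auto
    also have "\<dots> \<le> (\<Sum>j<d. (cmod (A i j))\<^sup>2) * (\<Sum>j<d. (cmod (v j))\<^sup>2)"
      by (rule Cauchy_Schwarz_ineq_sum)
    finally show ?thesis by (simp add: vsq_def)
  qed
  then have "vsq (mv A v) \<le> (\<Sum>i<d. (\<Sum>j<d. (cmod (A i j))\<^sup>2) * vsq v)"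
    unfolding vsq_def[of "mv A v"] by (intro sum_mono)
  then show ?thesis by (simp add: nrm_eq sum_distrib_right)
qed

lemma mv_diff: "mv (A - B) v i = mv A v i - mv B v i"
  by (simp add: mv_def left_diff_distrib sum_subtractf)

lemma mv_msmult_mone: "i < d \<Longrightarrow> mv (msmult c mone) v i = c * v i"
  by (simp add: mv_def msmult_def mone_def if_distrib[of "\<lambda>x. x * _"] if_distrib[of "\<lambda>x. _ * x"] cong: if_cong)

lemma Re_sum_cnj_self: "Re (\<Sum>i<d. cnj (v i) * v i) = vsq v"
  by (simp add: vsq_def cmod_power2) (simp add: power2_eq_square)

lemma qf_diff_msmult_mone: "qf (A - msmult (of_real c) mone) v = qf A v - c * vsq v"
proof -
  have "qf (A - msmult (of_real c) mone) v =
      Re (\<Sum>i<d. cnj (v i) * mv A v i) - Re (\<Sum>i<d. of_real c * (cnj (v i) * v i))"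
    unfolding qf_def by (simp add: mv_diff mv_msmult_mone algebra_simps sum_subtractf)
  also have "Re (\<Sum>i<d. of_real c * (cnj (v i) * v i)) = c * vsq v"
    unfolding sum_distrib_left[symmetric] Re_sum_cnj_self[symmetric] by simp
  finally show ?thesis by (simp only: qf_def[of A])
qed

text \<open>If the form took a negative value, its best lower bound \<open>c\<close> would be negative, hence no
  eigenvalue, so \<open>A - c\<close> would be invertible; but an invertible positive semidefinite form is
  bounded below by a positive multiple of the identity, contradicting the choice of \<open>c\<close>.\<close>

lemma psd_if_eigenvalues_nonneg:
  assumes herm: "adj A = A"
    and ev: "\<And>(e::real) v. \<exists>i<d. v i \<noteq> 0 \<Longrightarrow> \<forall>i<d. mv A v i = of_real e * v i \<Longrightarrow> e \<ge> 0"
  shows "psd A"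
proof (rule ccontr)
  assume "\<not> psd A"
  then obtain v where v: "qf A v < 0" using herm by (auto simp: psd_def not_le)
  define S where "S = {c. \<forall>u. c * vsq u \<le> qf A u}"
  have le0: "c < 0" if "c \<in> S" for c
  proof (rule ccontr)
    assume "\<not> c < 0"
    then have "0 \<le> c * vsq v" using vsq_nonneg[of v] by simp
    also have "\<dots> \<le> qf A v" using that by (simp add: S_def)
    finally show False using v by simp
  qed
  \<comment> \<open>Some lower bound exists because the Frobenius norm controls the form, by
    \<open>abs_qf_le\<close> and \<open>vsq_mv_le_nrm\<close>.\<close>
  have "- (1 + nrm A) / 2 \<in> S"
    unfolding S_def mem_Collect_eq
  proof
    fix u show "- (1 + nrm A) / 2 * vsq u \<le> qf A u"
      using abs_qf_le[of A u] vsq_mv_le_nrm[of A u] by (simp add: algebra_simps)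
  qed
  then have ne: "S \<noteq> {}" by auto
  have bdd: "bdd_above S" using le0 by (intro bdd_aboveI[of _ 0]) (simp add: less_imp_le)
  define c where "c = Sup S"
  have cS: "c \<in> S"
    unfolding S_def mem_Collect_eq
  proof
    fix u
    show "c * vsq u \<le> qf A u"
    proof (cases "vsq u = 0")
      case True
      obtain b where "b \<in> S" using ne by auto
      then have "b * vsq u \<le> qf A u" by (simp add: S_def)
      then show ?thesis using True by simp
    next
      case False
      then have u: "vsq u > 0" using vsq_nonneg[of u] by simp
      have "c \<le> qf A u / vsq u"
        unfolding c_def using ne
      proof (rule cSup_least)
        fix b assume "b \<in> S"
        then show "b \<le> qf A u / vsq u" using u by (simp add: S_def field_simps)
      qed
      then show ?thesis using u by (simp add: field_simps)
    qed
  qed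
  define N where "N = A - msmult (of_real c) mone"
  have qN: "qf N u = qf A u - c * vsq u" for u
    unfolding N_def by (rule qf_diff_msmult_mone)
  have "adj N = N"
    unfolding N_def adj_diff herm by (auto simp: msmult_def adj_def mone_def fun_eq_iff)
  moreover have "qf N u \<ge> 0" for u using cS by (simp add: qN S_def)
  ultimately have psdN: "psd N" by (simp add: psd_def)
  obtain G where G: "\<And>u i. i < d \<Longrightarrow> mv G (mv N u) i = u i"
  proof (rule left_inverse_exists[of N])
    fix u assume u: "\<forall>i<d. mv N u i = 0"
    then have "\<forall>i<d. mv A u i = of_real c * u i" by (simp add: N_def mv_diff mv_msmult_mone)
    then show "\<forall>i<d. u i = 0" using ev[of u c] le0[OF cS] by force
  qed blast
  \<comment> \<open>Inverting \<open>N\<close> costs \<open>nrm G\<close>, and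
    \<open>vsq_mv_le\<close> turns \<open>vsq (mv N u)\<close> into trace times form. The added 1
    keeps \<open>K\<close> positive, so that \<open>c + 1 / K\<close> is a larger lower bound than
    \<open>c\<close>.\<close>
  define K where "K = nrm G * \<bar>ip mone N\<bar> + 1"
  have K: "K > 0" unfolding K_def using nrm_nonneg[of G] by (simp add: add_nonneg_pos)
  have "vsq u \<le> K * qf N u" for u
  proof -
    have q0: "qf N u \<ge> 0" using psdN by (simp add: psd_def)
    have "vsq u = vsq (mv G (mv N u))" by (simp add: vsq_def G)
    also have "\<dots> \<le> nrm G * vsq (mv N u)" by (rule vsq_mv_le_nrm)
    also have "\<dots> \<le> nrm G * (ip mone N * qf N u)"
      using vsq_mv_le[OF psdN] nrm_nonneg by (intro mult_left_mono)
    also have "\<dots> \<le> nrm G * (\<bar>ip mone N\<bar> * qf N u)"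
      using q0 nrm_nonneg by (intro mult_left_mono mult_right_mono) auto
    also have "\<dots> \<le> K * qf N u" using q0 by (simp add: K_def algebra_simps)
    finally show ?thesis .
  qed
  then have "c + 1 / K \<in> S" using K by (simp add: S_def qN field_simps)
  then have "c + 1 / K \<le> c" unfolding c_def using bdd by (rule cSup_upper)
  then show False using K by simp
qed

section \<open>Transfer between library matrices and functions\<close>

text \<open>Entries outside the corner are set to 0 because \<open>$$\<close> is unspecified there;
  this makes the Hermitian property an equality of functions.\<close>

definition emb :: "complex mat \<Rightarrow> cmat" where
  "emb A = (\<lambda>i j. if i < d \<and> j < d then A $$ (i, j) else 0)"

lemma mat_adjoint_index:
  assumes "A \<in> carrier_mat d d"
  shows "mat_adjoint A \<in> carrier_mat d d"
    and "i < d \<Longrightarrow> j < d \<Longrightarrow> mat_adjoint A $$ (i, j) = cnj (A $$ (j, i))"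
  using assms by (auto simp: mat_adjoint_def mat_of_rows_def)

lemma emb_mat_adjoint: "A \<in> carrier_mat d d \<Longrightarrow> emb (mat_adjoint A) = adj (emb A)"
  by (auto simp: emb_def adj_def mat_adjoint_index fun_eq_iff)

lemma emb_times:
  "A \<in> carrier_mat d d \<Longrightarrow> B \<in> carrier_mat d d \<Longrightarrow> emb (A * B) = mm (emb A) (emb B)"
  by (auto simp: emb_def mm_def fun_eq_iff scalar_prod_def atLeast0LessThan)

lemma adj_emb: "A \<in> carrier_mat d d \<Longrightarrow> hermitian_mat A \<Longrightarrow> adj (emb A) = emb A"
  by (metis emb_mat_adjoint hermitian_mat_def)

lemma mem_spectrum_iff:
  assumes A: "A \<in> carrier_mat d d"
  shows "e \<in> spectrum A \<longleftrightarrow> (\<exists>v. (\<exists>i<d. v i \<noteq> 0) \<and> (\<forall>i<d. mv (emb A) v i = e * v i))"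
proof -
  have mv: "(A *\<^sub>v v) $ i = mv (emb A) (\<lambda>j. v $ j) i" if "v \<in> carrier_vec d" "i < d" for v i
    using A that by (simp add: mv_def emb_def scalar_prod_def atLeast0LessThan)
  have "eigenvector A v e \<longleftrightarrow>
      (\<exists>i<d. v $ i \<noteq> 0) \<and> (\<forall>i<d. mv (emb A) (\<lambda>j. v $ j) i = e * v $ i)"
    if v: "v \<in> carrier_vec d" for v
  proof -
    have "v \<noteq> 0\<^sub>v d \<longleftrightarrow> (\<exists>i<d. v $ i \<noteq> 0)"
      using v by (auto simp: vec_eq_iff)
    moreover have "A *\<^sub>v v = e \<cdot>\<^sub>v v \<longleftrightarrow> (\<forall>i<d. mv (emb A) (\<lambda>j. v $ j) i = e * v $ i)"
      using v A mv[OF v] by (auto simp: vec_eq_iff)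
    ultimately show ?thesis using v A by (auto simp: eigenvector_def)
  qed
  note ev = this
  show ?thesis
  proof
    assume "e \<in> spectrum A"
    then obtain v where v: "eigenvector A v e" by (auto simp: spectrum_def eigenvalue_def)
    then have "v \<in> carrier_vec d" using A by (auto simp: eigenvector_def)
    from ev[OF this] v
    show "\<exists>v. (\<exists>i<d. v i \<noteq> 0) \<and> (\<forall>i<d. mv (emb A) v i = e * v i)" by blast
  next
    assume "\<exists>v. (\<exists>i<d. v i \<noteq> 0) \<and> (\<forall>i<d. mv (emb A) v i = e * v i)"
    then obtain v where v: "\<exists>i<d. v i \<noteq> 0" "\<forall>i<d. mv (emb A) v i = e * v i" by blast
    have "mv (emb A) (\<lambda>j. vec d v $ j) i = mv (emb A) v i" for i
      by (simp add: mv_def)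
    then have "eigenvector A (vec d v) e" using ev[of "vec d v"] v by auto
    then show "e \<in> spectrum A" by (auto simp: spectrum_def eigenvalue_def)
  qed
qed

lemma mv_mm: "i < d \<Longrightarrow> mv (mm A B) v i = mv A (mv B v) i"
proof -
  assume "i < d"
  then have "mv (mm A B) v i = (\<Sum>j<d. \<Sum>l<d. A i l * B l j * v j)"
    by (simp add: mv_def mm_def sum_distrib_right)
  also have "\<dots> = (\<Sum>l<d. \<Sum>j<d. A i l * B l j * v j)" by (rule sum.swap)
  finally show ?thesis by (simp add: mv_def sum_distrib_left mult.assoc)
qed

text \<open>A negative eigenvalue \<open>e\<close> of the identity minus
  \<open>mat_adjoint A * A\<close> would give the singular value \<open>sqrt (1 - e) > 1\<close>.
  Hence that matrix is semidefinite, \<open>A\<close> does not lengthen vectors, and this is applied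
  to each column of \<open>Z\<close>.\<close>

lemma schatten_contraction:
  assumes A: "A \<in> carrier_mat d d" and norm: "schatten_inf_norm A \<le> 1"
  shows "nrm (mm (emb A) Z) \<le> nrm Z"
proof -
  let ?a = "emb A" and ?P = "mat_adjoint A * A"
  have P: "?P \<in> carrier_mat d d" using A mat_adjoint_index(1)[OF A] by simp
  have embP: "emb ?P = mm (adj ?a) ?a"
    by (simp add: emb_times emb_mat_adjoint mat_adjoint_index(1) A)
  \<comment> \<open>Finiteness, inherited from the spectrum, makes \<open>Max\<close> an upper bound
    for the singular values.\<close>
  have "singular_values A \<subseteq> (\<lambda>z. sqrt (Re z)) ` spectrum ?P"
    by (force simp: singular_values_def image_iff)
  then have fin: "finite (singular_values A)"
    using card_finite_spectrum(1)[OF P] finite_surj by blast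
  define N where "N = msmult (of_real 1) mone - mm (adj ?a) ?a"
  have "psd N"
  proof (rule psd_if_eigenvalues_nonneg)
    show "adj N = N"
      unfolding N_def adj_diff adj_mm adj_adj by (auto simp: msmult_def adj_def mone_def fun_eq_iff)
    fix e :: real and v
    assume v: "\<exists>i<d. v i \<noteq> 0" "\<forall>i<d. mv N v i = of_real e * v i"
    have "\<forall>i<d. mv (emb ?P) v i = of_real (1 - e) * v i"
    proof (intro allI impI)
      fix i assume i: "i < d"
      have "v i - mv (emb ?P) v i = of_real e * v i"
        using v(2)[rule_format, OF i] i by (simp add: N_def mv_diff mv_msmult_mone embP)
      then show "mv (emb ?P) v i = of_real (1 - e) * v i" by (simp add: algebra_simps)
    qed
    then have spec: "of_real (1 - e) \<in> spectrum ?P" using v(1) mem_spectrum_iff[OF P] by blast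
    show "e \<ge> 0"
    proof (rule ccontr)
      assume "\<not> e \<ge> 0"
      then have s: "sqrt (1 - e) > 1" "(sqrt (1 - e))\<^sup>2 = 1 - e" by auto
      then have "sqrt (1 - e) \<in> singular_values A"
        using spec by (simp only: singular_values_def mem_Collect_eq) simp
      then have "sqrt (1 - e) \<le> schatten_inf_norm A"
        unfolding schatten_inf_norm_def using fin by (intro Max_ge)
      then show False using norm s(1) by linarith
    qed
  qed
  have vec: "vsq (mv ?a v) \<le> vsq v" for v
  proof -
    have 1: "mv (adj ?a) w i = (\<Sum>j<d. cnj (?a j i) * w j)" for w i
      by (simp add: mv_def adj_def)
    have 2: "cnj (mv ?a v j) = (\<Sum>i<d. cnj (v i) * cnj (?a j i))" for j
      by (simp add: mv_def mult.commute)
    have "(\<Sum>i<d. cnj (v i) * mv (mm (adj ?a) ?a) v i) =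
        (\<Sum>i<d. \<Sum>j<d. cnj (v i) * cnj (?a j i) * mv ?a v j)"
      by (simp add: mv_mm 1 sum_distrib_left mult.assoc)
    also have "\<dots> = (\<Sum>j<d. \<Sum>i<d. cnj (v i) * cnj (?a j i) * mv ?a v j)" by (rule sum.swap)
    also have "\<dots> = (\<Sum>j<d. cnj (mv ?a v j) * mv ?a v j)"
      by (simp only: 2 sum_distrib_right)
    finally have "Re (\<Sum>i<d. cnj (v i) * mv (mm (adj ?a) ?a) v i) = vsq (mv ?a v)"
      by (simp only: Re_sum_cnj_self)
    moreover have "qf N v = Re (\<Sum>i<d. cnj (v i) * v i) - Re (\<Sum>i<d. cnj (v i) * mv (mm (adj ?a) ?a) v i)"
      by (simp add: qf_def N_def mv_diff mv_msmult_mone right_diff_distrib sum_subtractf)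
    moreover have "qf N v \<ge> 0" using \<open>psd N\<close> by (simp add: psd_def)
    ultimately show ?thesis by (simp only: Re_sum_cnj_self)
  qed
  have cols: "nrm Y = (\<Sum>l<d. vsq (\<lambda>i. Y i l))" for Y
    unfolding nrm_eq vsq_def by (rule sum.swap)
  have "nrm (mm ?a Z) = (\<Sum>l<d. vsq (mv ?a (\<lambda>i. Z i l)))"
    unfolding cols by (simp add: vsq_def mm_def mv_def)
  also have "\<dots> \<le> nrm Z" unfolding cols by (intro sum_mono vec)
  finally show ?thesis .
qed

lemma is_density_emb:
  assumes "density_mat d \<rho>"
  shows "is_density (emb \<rho>)"
proof -
  have \<rho>: "\<rho> \<in> carrier_mat d d" "hermitian_mat \<rho>" "spectrum \<rho> \<subseteq> \<real>\<^sub>\<ge>\<^sub>0" "mat_trace \<rho> = 1"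
    using assms by (auto simp: density_mat_def psd_mat_def)
  have "psd (emb \<rho>)"
  proof (rule psd_if_eigenvalues_nonneg)
    fix e :: real and v
    assume "\<exists>i<d. v i \<noteq> 0" "\<forall>i<d. mv (emb \<rho>) v i = of_real e * v i"
    then have "of_real e \<in> spectrum \<rho>" using mem_spectrum_iff[OF \<rho>(1)] by blast
    then show "e \<ge> 0" using \<rho>(3) by (auto simp: complex_nonneg_Reals_iff)
  qed (rule adj_emb[OF \<rho>(1,2)])
  moreover have "ip mone (emb \<rho>) = Re (mat_trace \<rho>)"
    using \<rho>(1) by (simp add: ip_mone mat_trace_def emb_def)
  ultimately show ?thesis using \<rho>(4) by (simp add: is_density_def)
qed

text \<open>At an eigenvector the form equals the eigenvalue times \<open>vsq v > 0\<close>. It is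
  real since \<open>R\<close> is Hermitian and nonnegative since \<open>R\<close> is
  \<open>psd\<close>, so the eigenvalue is both.\<close>

lemma density_mat_of_fun:
  assumes R: "is_density R"
  defines "\<rho> \<equiv> mat d d (\<lambda>(i, j). R i j)"
  shows "density_mat d \<rho>" "hermitian_mat \<rho>" "\<rho> \<in> carrier_mat d d"
proof -
  have herm: "adj R = R" and pos: "\<And>v. qf R v \<ge> 0" and tr: "ip mone R = 1"
    using R by (auto simp: is_density_def psd_def)
  have sym: "cnj (R j i) = R i j" for i j using fun_cong[OF fun_cong[OF herm], of i j] by (simp add: adj_def)
  show \<rho>: "\<rho> \<in> carrier_mat d d" by (simp add: \<rho>_def)
  show hm: "hermitian_mat \<rho>"
    unfolding hermitian_mat_def
    by (rule eq_matI) (use mat_adjoint_index[OF \<rho>] in \<open>auto simp: \<rho>_def sym\<close>)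
  have mv: "mv (emb \<rho>) v i = mv R v i" if "i < d" for v i
    using that by (simp add: mv_def emb_def \<rho>_def)
  have "spectrum \<rho> \<subseteq> \<real>\<^sub>\<ge>\<^sub>0"
  proof
    fix e assume "e \<in> spectrum \<rho>"
    then obtain v where v: "\<exists>i<d. v i \<noteq> 0" "\<forall>i<d. mv R v i = e * v i"
      using mem_spectrum_iff[OF \<rho>] mv by auto
    then obtain i where i: "i < d" "v i \<noteq> 0" by blast
    have "0 < (cmod (v i))\<^sup>2" using i by simp
    also have "\<dots> \<le> vsq v" unfolding vsq_def using i by (intro member_le_sum) auto
    finally have vpos: "vsq v > 0" .
    have "(\<Sum>i<d. cnj (v i) * v i) = of_real (vsq v)"
      unfolding vsq_def of_real_sum by (intro sum.cong refl) (simp only: complex_norm_square mult.commute)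
    then have form: "(\<Sum>i<d. cnj (v i) * mv R v i) = e * of_real (vsq v)"
      using v(2) by (simp add: mult.left_commute flip: sum_distrib_left)
    have "Im (e * of_real (vsq v)) = 0"
      using hermitian_form[OF herm, of v v] unfolding form by (simp add: complex_eq_iff)
    moreover have "Re (e * of_real (vsq v)) \<ge> 0" using pos[of v] by (simp only: qf_def form)
    ultimately show "e \<in> \<real>\<^sub>\<ge>\<^sub>0" using vpos by (simp add: complex_nonneg_Reals_iff zero_le_mult_iff)
  qed
  moreover have "mat_trace \<rho> = 1"
  proof -
    have "Im (R i i) = 0" for i using sym[of i i] by (simp add: complex_eq_iff)
    then show ?thesis using tr by (simp add: ip_mone mat_trace_def \<rho>_def complex_eq_iff)
  qed
  ultimately show "density_mat d \<rho>" using \<rho> hm by (simp add: density_mat_def psd_mat_def)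
qed

text \<open>For Hermitian matrices the trace equals its own conjugate, so the real part taken in
  \<open>ip\<close> loses nothing.\<close>

lemma hs_inner_eq:
  assumes A: "A \<in> carrier_mat d d" "hermitian_mat A" and B: "B \<in> carrier_mat d d" "hermitian_mat B"
  shows "hs_inner A B = of_real (ip (emb A) (emb B))"
proof -
  let ?a = "emb A" and ?b = "emb B"
  have tr: "hs_inner A B = (\<Sum>i<d. \<Sum>j<d. cnj (?a j i) * ?b j i)"
    using A(1) B(1) mat_adjoint_index[OF A(1)]
    by (simp add: hs_inner_def mat_trace_def scalar_prod_def atLeast0LessThan emb_def)
  then have tr': "hs_inner A B = (\<Sum>i<d. \<Sum>j<d. cnj (?a i j) * ?b i j)"
    by (subst (asm) sum.swap)
  have a: "cnj (?a j i) = ?a i j" and b: "cnj (?b j i) = ?b i j" for i j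
    using fun_cong[OF fun_cong[OF adj_emb[OF A]], of i j] fun_cong[OF fun_cong[OF adj_emb[OF B]], of i j]
    by (simp_all add: adj_def)
  have "cnj (hs_inner A B) = (\<Sum>i<d. \<Sum>j<d. cnj (cnj (?a i j)) * cnj (?b i j))"
    unfolding tr' by simp
  also have "\<dots> = hs_inner A B" unfolding tr by (simp only: a b)
  finally have "Im (hs_inner A B) = 0" by (simp add: complex_eq_iff)
  moreover have "Re (hs_inner A B) = ip ?a ?b" unfolding tr' ip_def ..
  ultimately show ?thesis by (simp add: complex_eq_iff)
qed

end

subsection \<open>Sparsification\<close>

lemma power_of_two_between:
  fixes x :: real
  assumes "x \<ge> 1"
  obtains r :: nat where "x \<le> 2 ^ r" "2 ^ r \<le> 2 * x"
proof -
  have ex: "\<exists>r::nat. x \<le> 2 ^ r" using real_arch_pow[of 2 x] by (auto intro: less_imp_le)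
  define r where "r = (LEAST r::nat. x \<le> 2 ^ r)"
  have r: "x \<le> 2 ^ r" unfolding r_def by (rule LeastI_ex[OF ex])
  have "2 ^ r \<le> 2 * x"
  proof (cases r)
    case 0
    then show ?thesis using assms by simp
  next
    case (Suc n)
    have "\<not> x \<le> 2 ^ n" by (rule not_less_Least) (simp add: Suc flip: r_def)
    then show ?thesis using Suc by simp
  qed
  with r show thesis by (rule that)
qed

context corner_matrices
begin

section \<open>Bounds for shifted contractions and mixtures of density matrices\<close>

lemma ip_add_left: "ip (A + B) C = ip A C + ip B C"
  using ip_add_right[of C A B] by (simp only: ip_commute)

text \<open>The parallelogram law with the term \<open>nrm (A + B)\<close> dropped.\<close>

lemma nrm_diff_le: "nrm (A - B) \<le> 2 * nrm A + 2 * nrm B"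
proof -
  have diff: "nrm (A - B) = nrm A - ip B A - (ip A B - nrm B)"
    and add: "nrm (A + B) = nrm A + ip B A + (ip A B + nrm B)"
    by (simp_all only: ip_diff_left ip_diff_right ip_add_left ip_add_right)
  show ?thesis unfolding diff using nrm_nonneg[of "A + B", unfolded add] by linarith
qed

lemma nrm_msmult_le:
  assumes "\<bar>c\<bar> \<le> 1"
  shows "nrm (msmult (of_real c) A) \<le> nrm A"
proof -
  have "c * c \<le> 1" using assms by (simp add: abs_square_le_1 flip: power2_eq_square)
  then have "(c * c) * nrm A \<le> nrm A" using mult_right_mono[of "c * c" 1 "nrm A"] nrm_nonneg by simp
  then show ?thesis by (simp only: ip_msmult_left ip_msmult_right mult.assoc)
qed

lemma nrm_mm_mone: "nrm (mm mone Z) = nrm Z"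
  unfolding ip_def
  by (auto intro!: arg_cong[where f = Re] sum.cong
      simp: mm_def mone_def if_distrib[of "\<lambda>x. x * _"] cong: if_cong)

text \<open>Four contractions are combined in two layers of differences, each of which costs a
  factor 4 in the squared norm.\<close>

lemma nrm_mm_shifted_diff_le:
  assumes "\<And>Z. nrm (mm A Z) \<le> nrm Z" "\<And>Z. nrm (mm A' Z) \<le> nrm Z"
    and "\<bar>s\<bar> \<le> 1" "\<bar>s'\<bar> \<le> 1" "\<bar>c\<bar> \<le> 1" "\<bar>c'\<bar> \<le> 1"
  shows "nrm (mm ((msmult (of_real s) A - msmult (of_real c) mone) -
                  (msmult (of_real s') A' - msmult (of_real c') mone)) Z) \<le> 16 * nrm Z"
proof -
  let ?P = "msmult (of_real s) (mm A Z)" and ?Q = "msmult (of_real c) (mm mone Z)"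
  let ?P' = "msmult (of_real s') (mm A' Z)" and ?Q' = "msmult (of_real c') (mm mone Z)"
  have bound: "x \<le> 16 * n" if "x \<le> 2 * y + 2 * z" "y \<le> 2 * p + 2 * q" "z \<le> 2 * p' + 2 * q'"
    "p \<le> n" "q \<le> n" "p' \<le> n" "q' \<le> n" for x y z n p q p' q' :: real
    using that by linarith
  have P: "nrm ?P \<le> nrm Z" using nrm_msmult_le[OF assms(3)] assms(1) order_trans by blast
  have P': "nrm ?P' \<le> nrm Z" using nrm_msmult_le[OF assms(4)] assms(2) order_trans by blast
  have Q: "nrm ?Q \<le> nrm Z" using nrm_msmult_le[OF assms(5), of "mm mone Z"] by (simp only: nrm_mm_mone)
  have Q': "nrm ?Q' \<le> nrm Z" using nrm_msmult_le[OF assms(6), of "mm mone Z"] by (simp only: nrm_mm_mone)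
  have "nrm ((?P - ?Q) - (?P' - ?Q')) \<le> 16 * nrm Z"
    by (rule bound[OF nrm_diff_le nrm_diff_le nrm_diff_le P Q P' Q'])
  then show ?thesis by (simp only: mm_diff_left mm_msmult_left)
qed

lemma is_density_convex:
  assumes "is_density R" "is_density R'" "0 \<le> u" "u \<le> 1"
  shows "is_density (msmult (of_real (1 - u)) R + msmult (of_real u) R')"
proof -
  let ?R = "msmult (of_real (1 - u)) R + msmult (of_real u) R'"
  have herm: "cnj (R j i) = R i j" "cnj (R' j i) = R' i j" for i j
    using assms(1,2) by (metis adj_def is_density_def psd_def)+
  have "adj ?R = ?R" by (simp add: adj_def msmult_def herm fun_eq_iff)
  moreover have "qf ?R v \<ge> 0" for v
  proof -
    have "mv ?R v i = of_real (1 - u) * mv R v i + of_real u * mv R' v i" for i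
      by (simp add: mv_def msmult_def distrib_right sum.distrib sum_distrib_left mult.assoc)
    then have "qf ?R v = Re (of_real (1 - u) * (\<Sum>i<d. cnj (v i) * mv R v i) +
        of_real u * (\<Sum>i<d. cnj (v i) * mv R' v i))"
      unfolding qf_def sum_distrib_left
      by (simp only: distrib_left sum.distrib mult.left_commute)
    also have "\<dots> = (1 - u) * qf R v + u * qf R' v"
      by (simp only: qf_def plus_complex.sel Re_complex_of_real times_complex.sel Im_complex_of_real mult_zero_left diff_zero)
    finally show ?thesis using assms by (simp add: is_density_def psd_def)
  qed
  moreover have "ip mone ?R = 1"
    using assms by (simp only: ip_add_right ip_msmult_right is_density_def) simp
  ultimately show ?thesis by (simp add: is_density_def psd_def)
qed

text \<open>If no \<open>k\<close>-tuple worked, every sample average would deviate from its mean by \<open>\<gamma>\<close>,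
  which the moment bound of order \<open>2 p\<close> with \<open>p \<approx> ln d\<close> excludes.\<close>

lemma positive_tuple_exists:
  fixes B :: "'i \<Rightarrow> cmat" and k :: nat
  assumes fin: "finite I" and w: "\<And>i. i \<in> I \<Longrightarrow> w i \<ge> 0" "(\<Sum>i\<in>I. w i) = 1"
    and herm: "\<And>i. i \<in> I \<Longrightarrow> adj (B i) = B i"
    and D: "\<And>i l Z. i \<in> I \<Longrightarrow> l \<in> I \<Longrightarrow> nrm (mm (B i - B l) Z) \<le> 16 * nrm Z"
    and d: "d \<ge> 3" and k: "k \<ge> 1"
    and gap: "\<And>R. is_density R \<Longrightarrow> (\<Sum>i\<in>I. w i * ip R (B i)) \<ge> 20 * sqrt (ln d / k)"
  obtains \<iota> where "\<iota> \<in> {..<k} \<rightarrow>\<^sub>E I" "\<And>R. is_density R \<Longrightarrow> (\<Sum>j<k. ip R (B (\<iota> j))) > 0"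
proof (rule ccontr)
  assume contra: "\<not> thesis"
  note tuple = that
  have bad: "\<exists>R. is_density R \<and> (\<Sum>j<k. ip R (B (\<iota> j))) \<le> 0" if "\<iota> \<in> {..<k} \<rightarrow>\<^sub>E I" for \<iota>
    using contra tuple[OF that] by (meson not_less)
  have lnd: "ln (real d) \<ge> 1"
    using exp_le d by (subst ln_ge_iff) auto
  obtain r where r: "ln (real d) \<le> 2 ^ r" "2 ^ r \<le> 2 * ln (real d)"
    using power_of_two_between[OF lnd] .
  \<comment> \<open>A power of two, as \<open>ip_density_power_le\<close> demands, and within a
    factor 2 above \<open>ln d\<close>.\<close>
  define p :: nat where "p = 2 ^ r"
  have p: "ln (real d) \<le> real p" "real p \<le> 2 * ln (real d)" "p > 0" using r by (auto simp: p_def)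
  define \<gamma> where "\<gamma> = 20 * sqrt (ln d / k)"
  have \<gamma>0: "\<gamma> \<ge> 0" using lnd by (simp add: \<gamma>_def)
  define M where "M = (\<Sum>i\<in>I. msmult (of_real (w i)) (B i))"
  define H where "H i = B i - M" for i
  define X where "X \<iota> = (\<Sum>j<k. H (\<iota> j))" for \<iota> :: "nat \<Rightarrow> 'i"
  have ipM: "ip R M = (\<Sum>i\<in>I. w i * ip R (B i))" for R
    by (simp only: M_def ip_sum_right ip_msmult_right)
  have "adj (msmult (of_real (w i)) (B i)) = msmult (of_real (w i)) (B i)" if "i \<in> I" for i
    using fun_cong[OF fun_cong[OF herm[OF that]]] by (simp add: adj_def msmult_def fun_eq_iff)
  then have "adj M = M" unfolding M_def adj_sum by (intro sum.cong) auto
  then have hermH: "adj (H i) = H i" if "i \<in> I" for i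
    using herm[OF that] by (simp only: H_def adj_diff)
  have hermX: "adj (X \<iota>) = X \<iota>" if "\<iota> \<in> {..<k} \<rightarrow>\<^sub>E I" for \<iota>
    unfolding X_def adj_sum using that by (intro sum.cong hermH) auto
  have mean: "(\<Sum>i\<in>I. w i * ip (H i) Z) = 0" for Z
  proof -
    have "ip (H i) Z = ip Z (B i) - ip Z M" for i
      unfolding H_def by (subst ip_commute) (rule ip_diff_right)
    then have "(\<Sum>i\<in>I. w i * ip (H i) Z) = (\<Sum>i\<in>I. w i * ip Z (B i)) - (\<Sum>i\<in>I. w i) * ip Z M"
      by (simp only: right_diff_distrib sum_subtractf sum_distrib_right)
    then show ?thesis by (simp only: w ipM mult_1_left diff_self)
  qed
  \<comment> \<open>The mean \<open>M\<close> pairs to at least \<open>\<gamma>\<close> with every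
    density matrix, so a density matrix on which the drawn sum is not positive sees the centred sum
    below \<open>- k * \<gamma>\<close>.\<close>
  have lower: "(k * \<gamma>) ^ (2 * p) \<le> nrm (mpow (X \<iota>) p)" if \<iota>: "\<iota> \<in> {..<k} \<rightarrow>\<^sub>E I" for \<iota>
  proof -
    obtain R where R: "is_density R" "(\<Sum>j<k. ip R (B (\<iota> j))) \<le> 0" using bad[OF \<iota>] by blast
    have "ip R (X \<iota>) = (\<Sum>j<k. ip R (B (\<iota> j))) - k * ip R M"
      by (simp only: X_def ip_sum_right H_def ip_diff_right sum_subtractf) simp
    moreover have "k * \<gamma> \<le> k * ip R M"
      unfolding ipM \<gamma>_def using gap[OF R(1)] by (intro mult_left_mono) auto
    ultimately have "k * \<gamma> \<le> - ip R (X \<iota>)" using R(2) by linarith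
    then have "(k * \<gamma>) ^ (2 * p) \<le> (- ip R (X \<iota>)) ^ (2 * p)" using \<gamma>0 by (intro power_mono) auto
    also have "\<dots> = ip R (X \<iota>) ^ (2 * p)" by simp
    also have "\<dots> \<le> nrm (mpow (X \<iota>) p)"
      unfolding p_def by (rule ip_density_power_le[OF R(1) hermX[OF \<iota>]])
    finally show ?thesis .
  qed
  have "(k * \<gamma>) ^ (2 * p) = expect k I w (\<lambda>_. (k * \<gamma>) ^ (2 * p))"
    by (rule expect_const[OF fin w(2), symmetric])
  also have "\<dots> \<le> expect k I w (\<lambda>\<iota>. nrm (mpow (X \<iota>) p))"
    using w(1) lower by (rule expect_mono)
  also have "\<dots> \<le> d * (real (2 * p * k) * 16) ^ p"
    unfolding X_def
  proof (rule expect_moment_le[OF fin w hermH mean])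
    fix i l Z assume "i \<in> I" "l \<in> I"
    moreover have "H i - H l = B i - B l" by (simp add: H_def fun_eq_iff)
    ultimately show "nrm (mm (H i - H l) Z) \<le> 16 * nrm Z" using D by simp
  qed auto
  \<comment> \<open>The dimension is absorbed into the base:
    \<open>d \<le> exp 1 ^ p \<le> 3 ^ p\<close> because \<open>ln d \<le> p\<close>.\<close>
  also have "\<dots> \<le> (3 * (real (2 * p * k) * 16)) ^ p"
  proof -
    have "real d = exp (ln d)" using d by simp
    also have "\<dots> \<le> exp (real p)" using p(1) by simp
    also have "\<dots> = exp 1 ^ p" by (simp flip: exp_of_nat_mult)
    also have "\<dots> \<le> 3 ^ p" using exp_le by (intro power_mono) auto
    finally show ?thesis unfolding power_mult_distrib[of 3] by (intro mult_right_mono) auto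
  qed
  \<comment> \<open>Here the constant 20 enters: the base on the left is \<open>96 * p * k\<close>,
    at most \<open>192 * k * ln d\<close>, while \<open>(k * \<gamma>)\<^sup>2\<close> is
    \<open>400 * k * ln d\<close>.\<close>
  also have "\<dots> < ((k * \<gamma>)\<^sup>2) ^ p"
  proof (rule power_strict_mono)
    have "(k * \<gamma>)\<^sup>2 = 400 * k * ln d"
      using k lnd by (simp add: \<gamma>_def power_mult_distrib power2_eq_square[of "real k"])
    moreover have "3 * (2 * real p * real k * 16) \<le> 192 * k * ln d"
      using mult_left_mono[OF p(2), of "96 * real k"] by (simp add: mult_ac)
    moreover have "0 < k * ln d" using k lnd by simp
    ultimately show "3 * (real (2 * p * k) * 16) < (k * \<gamma>)\<^sup>2" by simp
  qed (use p in auto)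
  finally show False by (simp add: power_mult)
qed

end

theorem theorem1p3:
  fixes d m k :: nat
    and A :: "nat \<Rightarrow> complex mat"
    and b :: "nat \<Rightarrow> real"
    and t :: real
  assumes "d \<ge> 3" and "m \<ge> 1" and "k \<in> {1..m}"
    and "\<And>i. i \<in> {1..m} \<Longrightarrow> A i \<in> carrier_mat d d"
    and "\<And>i. i \<in> {1..m} \<Longrightarrow> hermitian_mat (A i)"
    and "\<And>i. i \<in> {1..m} \<Longrightarrow> schatten_inf_norm (A i) \<le> 1"
    and "t \<ge> 0"
    and "\<And>J. J \<subseteq> {1..m} \<Longrightarrow> card J = k \<Longrightarrow>
           \<exists>\<rho>. density_mat d \<rho> \<and>
             (\<forall>j\<in>J. cmod (hs_inner (A j) \<rho> - complex_of_real (b j)) \<le> t)"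
  shows "\<exists>\<rho>. density_mat d \<rho> \<and>
           (\<forall>i\<in>{1..m}. cmod (hs_inner (A i) \<rho> - complex_of_real (b i))
              \<le> t + 21 * sqrt (ln (real d) / real k))"
proof -
  interpret corner_matrices d .
  have cmod_diff: "cmod (of_real x - of_real y) = \<bar>x - y\<bar>" for x y :: real
    by (simp only: of_real_diff[symmetric] norm_of_real)
  define \<sigma> where "\<sigma> = sqrt (ln (real d) / real k)"
  have k: "k \<ge> 1" "k \<le> m" using assms(3) by auto
  have \<sigma>: "\<sigma> > 0" using assms(1) k by (simp add: \<sigma>_def)
  define a where "a i = emb (A i)" for i
  \<comment> \<open>A pair \<open>x\<close> of an index and a sign stands for one side of a
    two-sided constraint. The cut at 1 excludes no solution, since the inner products are at most 1
    in modulus, and it keeps the matrices \<open>B x\<close> bounded.\<close>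
  define c where "c x = min 1 (t + snd x * b (fst x))" for x :: "nat \<times> real"
  define B where "B x = msmult (of_real (snd x)) (a (fst x)) - msmult (of_real (c x)) mone"
    for x :: "nat \<times> real"
  define I :: "(nat \<times> real) set" where "I = {1..m} \<times> {1, -1}"
  have fin: "finite I" by (simp add: I_def)
  have herm: "adj (a i) = a i" if "i \<in> {1..m}" for i
    unfolding a_def using assms(4,5) that by (intro adj_emb)
  have contr: "nrm (mm (a i) Z) \<le> nrm Z" if "i \<in> {1..m}" for i Z
    unfolding a_def using assms(4,6) that by (intro schatten_contraction)
  have a1: "\<bar>ip R (a i)\<bar> \<le> 1" if "is_density R" "i \<in> {1..m}" for R i
    using that herm contr by (intro abs_ip_density_contraction)
  have ipB: "ip R (B x) = snd x * ip R (a (fst x)) - c x" if "is_density R" for R x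
    using that by (simp only: B_def ip_diff_right ip_msmult_right is_density_def ip_commute[of R mone] mult_1_right)
  \<comment> \<open>Draws may repeat an index, so sets with fewer than \<open>k\<close> elements are
    covered too, by enlarging them.\<close>
  have local_sol: "\<exists>R. is_density R \<and> (\<forall>j\<in>J. \<bar>ip R (a j) - b j\<bar> \<le> t)"
    if J: "J \<subseteq> {1..m}" "card J \<le> k" for J
  proof -
    obtain J' where J': "J \<subseteq> J'" "J' \<subseteq> {1..m}" "card J' = k"
      using exists_subset_between[of J k "{1..m}"] J k by auto
    obtain \<rho> where \<rho>: "density_mat d \<rho>" "\<forall>j\<in>J'. cmod (hs_inner (A j) \<rho> - complex_of_real (b j)) \<le> t"
      using assms(8)[OF J'(2,3)] by blast
    have "\<bar>ip (emb \<rho>) (a j) - b j\<bar> \<le> t" if "j \<in> J'" for j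
    proof -
      have "hs_inner (A j) \<rho> = of_real (ip (a j) (emb \<rho>))"
        unfolding a_def using \<rho>(1) assms(4,5) J'(2) that
        by (intro hs_inner_eq) (auto simp: density_mat_def psd_mat_def)
      then show ?thesis using \<rho>(2) that by (metis cmod_diff ip_commute)
    qed
    then show ?thesis using is_density_emb[OF \<rho>(1)] J'(1) by blast
  qed
  \<comment> \<open>The upper bound is the cut; the lower one holds because the constraint alone is
    satisfiable by a density matrix, whose inner product is at least -1 with either sign.\<close>
  have c1: "\<bar>c x\<bar> \<le> 1" if x: "x \<in> I" for x
  proof -
    have i: "fst x \<in> {1..m}" and s: "snd x = 1 \<or> snd x = -1" using x by (auto simp: I_def)
    obtain R where R: "is_density R" "\<bar>ip R (a (fst x)) - b (fst x)\<bar> \<le> t"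
      using local_sol[of "{fst x}"] i k by auto
    then have "t + snd x * b (fst x) \<ge> -1" using a1[OF R(1) i] s by auto
    then show ?thesis by (simp add: c_def)
  qed
  \<comment> \<open>The shift by \<open>20 * \<sigma>\<close> is the gap required for sampling, and
    the minimax slack contributes one more \<open>\<sigma>\<close>; together they give the constant
    21.\<close>
  define S where "S = {x. \<exists>R. is_density R \<and> x = (\<lambda>i. ip R (B i) - 20 * \<sigma>)}"
  have "\<exists>x\<in>S. \<forall>i\<in>I. x i \<le> \<sigma>"
  proof (rule ccontr)
    assume "\<not> ?thesis"
    then have infeasible: "\<exists>i\<in>I. x i > \<sigma>" if "x \<in> S" for x using that by (auto simp: not_le)
    obtain w where w: "\<And>i. i \<in> I \<Longrightarrow> w i \<ge> 0" "(\<Sum>i\<in>I. w i) = 1"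
      "\<And>x. x \<in> S \<Longrightarrow> (\<Sum>i\<in>I. w i * x i) \<ge> 0"
    proof (rule approximate_minimax[OF fin _ _ _ \<sigma> infeasible])
      show "S \<noteq> {}" using local_sol[of "{}"] by (auto simp: S_def)
      show "(\<lambda>i. (1 - u) * x i + u * y i) \<in> S" if xy: "x \<in> S" "y \<in> S" and u: "0 \<le> u" "u \<le> 1" for x y u
      proof -
        obtain R R' where R: "is_density R" "x = (\<lambda>i. ip R (B i) - 20 * \<sigma>)"
          "is_density R'" "y = (\<lambda>i. ip R' (B i) - 20 * \<sigma>)"
          using xy by (auto simp: S_def)
        let ?R = "msmult (of_real (1 - u)) R + msmult (of_real u) R'"
        have ipR: "ip ?R (B i) = (1 - u) * ip R (B i) + u * ip R' (B i)" for i
          by (simp only: ip_add_left ip_msmult_left)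
        have "(\<lambda>i. (1 - u) * x i + u * y i) = (\<lambda>i. ip ?R (B i) - 20 * \<sigma>)"
          unfolding R(2,4) ipR by (simp add: algebra_simps)
        then show ?thesis using is_density_convex[OF R(1,3) u] unfolding S_def by blast
      qed
      show "\<bar>x i\<bar> \<le> 2 + 20 * \<sigma>" if "x \<in> S" "i \<in> I" for x i
      proof -
        obtain R where R: "is_density R" "x i = ip R (B i) - 20 * \<sigma>" using \<open>x \<in> S\<close> by (auto simp: S_def)
        have "fst i \<in> {1..m}" "snd i = 1 \<or> snd i = -1" using \<open>i \<in> I\<close> by (auto simp: I_def)
        then have "\<bar>ip R (B i)\<bar> \<le> 2"
          using a1[OF R(1), of "fst i"] c1[OF \<open>i \<in> I\<close>] unfolding ipB[OF R(1)] by auto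
        then show ?thesis using R(2) \<sigma> by linarith
      qed
    qed (assumption, rule that)
    obtain \<iota> where \<iota>: "\<iota> \<in> {..<k} \<rightarrow>\<^sub>E I"
      and pos: "\<And>R. is_density R \<Longrightarrow> (\<Sum>j<k. ip R (B (\<iota> j))) > 0"
    proof (rule positive_tuple_exists[OF fin w(1,2) _ _ assms(1) k(1)])
      show "adj (B x) = B x" if "x \<in> I" for x
      proof -
        have "cnj (a (fst x) j i) = a (fst x) i j" for i j
          using herm[of "fst x"] that by (metis I_def adj_def mem_Times_iff)
        then show ?thesis by (auto simp: B_def adj_def msmult_def mone_def fun_eq_iff)
      qed
      show "nrm (mm (B x - B y) Z) \<le> 16 * nrm Z" if "x \<in> I" "y \<in> I" for x y Z
        unfolding B_def using that c1[OF that(1)] c1[OF that(2)]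
        by (intro nrm_mm_shifted_diff_le contr) (auto simp: I_def)
      show "20 * sqrt (ln (real d) / real k) \<le> (\<Sum>i\<in>I. w i * ip R (B i))" if "is_density R" for R
      proof -
        have "0 \<le> (\<Sum>i\<in>I. w i * (ip R (B i) - 20 * \<sigma>))" using w(3) that by (auto simp: S_def)
        also have "\<dots> = (\<Sum>i\<in>I. w i * ip R (B i)) - (\<Sum>i\<in>I. w i) * (20 * \<sigma>)"
          by (simp only: right_diff_distrib sum_subtractf sum_distrib_right)
        finally show ?thesis using w(2) by (simp add: \<sigma>_def)
      qed
    qed (assumption, rule that)
    define J where "J = (\<lambda>j. fst (\<iota> j)) ` {..<k}"
    have \<iota>I: "\<iota> j \<in> I" if "j < k" for j using \<iota> that by auto
    have "J \<subseteq> {1..m}" using \<iota>I by (force simp: J_def I_def)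
    moreover have "card J \<le> k" using card_image_le[of "{..<k}" "\<lambda>j. fst (\<iota> j)"] by (simp add: J_def)
    ultimately obtain R where R: "is_density R" "\<forall>j\<in>J. \<bar>ip R (a j) - b j\<bar> \<le> t"
      using local_sol by blast
    \<comment> \<open>The signed inner product is at most the uncut bound by the choice of
      \<open>R\<close>, and at most 1 by \<open>a1\<close>, hence at most their minimum
      \<open>c\<close>.\<close>
    have "ip R (B (\<iota> j)) \<le> 0" if "j < k" for j
    proof -
      have i: "fst (\<iota> j) \<in> {1..m}" and s: "snd (\<iota> j) = 1 \<or> snd (\<iota> j) = -1"
        using \<iota>I[OF that] by (auto simp: I_def)
      have "\<bar>ip R (a (fst (\<iota> j))) - b (fst (\<iota> j))\<bar> \<le> t" using R(2) that by (auto simp: J_def)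
      then show ?thesis using s a1[OF R(1) i] unfolding ipB[OF R(1)] c_def by auto
    qed
    then have "(\<Sum>j<k. ip R (B (\<iota> j))) \<le> 0" by (intro sum_nonpos) auto
    then show False using pos[OF R(1)] by linarith
  qed
  then obtain R where R: "is_density R" and le: "\<And>x. x \<in> I \<Longrightarrow> ip R (B x) - 20 * \<sigma> \<le> \<sigma>"
    by (auto simp: S_def)
  define \<rho> where "\<rho> = mat d d (\<lambda>(i, j). R i j)"
  note \<rho> = density_mat_of_fun[OF R, folded \<rho>_def]
  have "cmod (hs_inner (A i) \<rho> - complex_of_real (b i)) \<le> t + 21 * \<sigma>" if i: "i \<in> {1..m}" for i
  proof -
    have "ip (a i) (emb \<rho>) = ip (a i) R" by (simp add: ip_def emb_def \<rho>_def)
    then have "hs_inner (A i) \<rho> = of_real (ip R (a i))"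
      using hs_inner_eq[OF assms(4,5)[OF i] \<rho>(3,2)] by (simp add: a_def ip_commute)
    moreover have "s * (ip R (a i) - b i) \<le> t + 21 * \<sigma>" if "s = 1 \<or> s = -1" for s
    proof -
      have "(i, s) \<in> I" using i that by (auto simp: I_def)
      from le[OF this] have "s * ip R (a i) - c (i, s) \<le> 21 * \<sigma>" unfolding ipB[OF R] by simp
      moreover have "c (i, s) \<le> t + s * b i" by (simp add: c_def)
      ultimately show ?thesis by (simp add: right_diff_distrib)
    qed
    from this[of 1] this[of "-1"] have "\<bar>ip R (a i) - b i\<bar> \<le> t + 21 * \<sigma>" by auto
    ultimately show ?thesis by (simp only: cmod_diff)
  qed
  then show ?thesis using \<rho>(1) unfolding \<sigma>_def by blast
qed

end
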